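(* For type expressions $A_1,\dots,A_n,B$ the following are equivalent: (a) $\{A_1,\dots,A_n\}\vdash B$ is derivable in $\mathbf{LA}\mu$; (b) $\{x_1:A_1,\dots,x_n:A_n\}\vdash M:B$ is derivable in $\lambda$A for some distinct individual variables $x_1,\dots,x_n$ and some $\lambda$-term $M$; (c) for every $\mathbf{LA}$-frame $(\mathcal W,\rhd,R)$, every hereditary valuation $\xi$ and every $p\in\mathcal W$, if $\models^\xi_p A_i$ for all $i$ then $\models^\xi_p B$.
   Context: Type expressions: fix a countably infinite set of type variables $X,Y,Z,\dots$. Pseudo type expressions are generated by $A::=X\mid A\to A\mid \bullet A\mid \mu X.A$ ($\mu$ binds $X$; $\alpha$-convertible expressions are identified; $\to$ associates to the right; $\bullet$ binds tighter than $\to$, which binds tighter than $\mu$). $A[B/X]$ denotes capture-avoiding substitution. $\top$ abbreviates $\mu X.\bullet X$, and $\bullet^n A$ denotes $A$ prefixed by $n$ copies of $\bullet$. The tail $t(A)$ is defined by $t(X)=X$, $t(A\to B)=t(B)$, $t(\bullet A)=\bullet t(A)$, $t(\mu X.A)=\mu X.t(A)$; it always has the form $\bullet^{m_0}\mu X_1.\bullet^{m_1}\mu X_2.\cdots\mu X_n.\bullet^{m_n}Y$. $A$ is a $\top$-variant iff $Y=X_i$ for some $1\le i\le n$ with $X_i\notin\{X_{i+1},\dots,X_n\}$ and $m_i+\dots+m_n\ge 1$. $A$ is proper in $X$ iff: a variable $Y$ is proper in $X$ iff $Y\neq X$; $\bullet A$ is always proper in $X$; $A\to B$ is proper in $X$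 iff both $A,B$ are proper in $X$ or $B$ is a $\top$-variant; for $Y\ne X$, $\mu Y.A$ is proper in $X$ iff $A$ is proper in $X$ or $\mu Y.A$ is a $\top$-variant. Type expressions are the least set of pseudo type expressions containing all type variables, closed under $\to$ and $\bullet$, and containing $\mu X.A$ whenever it contains $A$ and $A$ is proper in $X$. Equality: $\cong$ is the least relation on type expressions such that: $A\cong A$; $A\cong B$ implies $B\cong A$; $A\cong B$ and $B\cong C$ imply $A\cong C$; $A\cong B$ implies $\bullet A\cong\bullet B$; $A\cong C$ and $B\cong D$ imply $A\to B\cong C\to D$; $A\to\top\cong\top$; $\mu X.A\cong A[\mu X.A/X]$; and if $A\cong C[A/X]$ with $C$ proper in $X$, then $A\cong\mu X.C$. $\simeq$ is the least relation satisfying the same closure conditions and additionally $\bullet(A\to B)\simeq\bullet A\to\bullet B$. Subtyping: a subtyping assumption $\gamma$ is a finite set of pairs $X\preceq Y$ of type variables in which each type variable occurs at most once; $FTV(\gamma)$ is the set of variables occurring in it. Judgments $\gamma\vdash A\preceq B$ are derived by the rules: $\gamma\cup\{X\preceq Y\}\vdash X\preceq Y$; $\gamma\vdash A\preceq\top$; from $A\simeq B$ infer $\gamma\vdash A\preceq B$; from $\gamma_1\vdash A\preceq B$ and $\gamma_2\vdash B\preceq C$ infer $\gamma_1\cup\gamma_2\vdash A\preceq C$; from $\gamma\vdash A\preceq B$ infer $\gamma\vdash\bullet A\preceq\bullet B$; from $\gamma_1\vdash A'\preceq A$ and $\gamma_2\vdash B\preceq B'$ infer $\gamma_1\cup\gamma_2\vdash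 A\to B\preceq A'\to B'$; from $\gamma\cup\{X\preceq Y\}\vdash A\preceq B$ infer $\gamma\vdash\mu X.A\preceq\mu Y.B$, provided $X\notin FTV(\gamma)\cup FTV(B)$, $Y\notin FTV(\gamma)\cup FTV(A)$, $A$ is proper in $X$ and $B$ is proper in $Y$; and $\gamma\vdash A\preceq\bullet A$. All sets $\gamma\cup\{X\preceq Y\}$, $\gamma_1\cup\gamma_2$ must be well-formed subtyping assumptions. $A\preceq B$ means $\{\}\vdash A\preceq B$ is derivable. Typing system $\lambda$A: untyped $\lambda$-terms $M::=x\mid\lambda x.M\mid MM$ (identified up to $\alpha$-conversion). A typing context $\Gamma$ is a finite map from individual variables to type expressions, written $\{x_1:A_1,\dots,x_n:A_n\}$; $\bullet\Gamma$ is $\{x_1:\bullet A_1,\dots,x_n:\bullet A_n\}$; unions of contexts must be well-formed (a variable receives at most one type). Rules: (var) $\Gamma\cup\{x:A\}\vdash x:A$; (shift) from $\bullet\Gamma\vdash M:\bullet A$ infer $\Gamma\vdash M:A$; ($\top$) $\Gamma\vdash M:\top$; ($\preceq$) from $\Gamma\vdash M:A$ and $A\preceq B$ infer $\Gamma\vdash M:B$; ($\to$I) from $\Gamma\cup\{x:A\}\vdash M:B$ infer $\Gamma\vdash\lambda x.M:A\to B$; ($\to$E) from $\Gamma_1\vdash M:A\to B$ and $\Gamma_2\vdash N:A$ infer $\Gamma_1\cup\Gamma_2\vdash MN:B$. The formal system $\mathbf{LA}\mu$ derives judgments $\Gamma\vdash A$ ($\Gamma$ a finite set of formulae, i.e.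 type expressions; $\bullet\Gamma=\{\bullet B\mid B\in\Gamma\}$) by the rules: (assump) $\Gamma\cup\{A\}\vdash A$; (nec) from $\Gamma_1\vdash A$ infer $\bullet\Gamma_1\cup\Gamma_2\vdash\bullet A$; (4) from $\Gamma\vdash\bullet A$ infer $\Gamma\vdash\bullet\bullet A$; ($\to$I) from $\Gamma\cup\{A\}\vdash B$ infer $\Gamma\vdash A\to B$; ($\to$E) from $\Gamma_1\vdash A\to B$ and $\Gamma_2\vdash A$ infer $\Gamma_1\cup\Gamma_2\vdash B$; (fold) from $\Gamma\vdash A[\mu X.A/X]$ infer $\Gamma\vdash\mu X.A$; (unfold) from $\Gamma\vdash\mu X.A$ infer $\Gamma\vdash A[\mu X.A/X]$; (L) from $\Gamma\vdash\bullet A\to\bullet B$ infer $\Gamma\vdash\bullet(A\to B)$; (approx) from $\Gamma\vdash A$ infer $\Gamma\vdash\bullet A$. Kripke semantics: an $\mathbf{LA}$-frame is a triple $(\mathcal W,\rhd,R)$ with $\mathcal W$ nonempty, $\rhd$ a binary relation with no infinite chain $p_0\rhd p_1\rhd\cdots$, $R$ reflexive and transitive, such that: $pRq\rhd r$ implies $p\rhd r$; $p\rhd q$ implies $pRq$; and whenever $p\rhd q\,R\,q'$ there is $r$ with $pRr\rhd q'$ such that $r\rhd s$ implies $q'Rs$ for every $s$. A valuation $\xi$ assigns to each type variable a map $\mathcal W\to\{\mathbf t,\mathbf f\}$; it is hereditary if $pRq$ and $\xi(X)(p)=\mathbf t$ imply $\xi(X)(q)=\mathbf t$. Forcing $\models^\xi_p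 A$ is defined by well-founded induction: $\models^\xi_p A$ if $A$ is a $\top$-variant; otherwise $\models^\xi_p X$ iff $\xi(X)(p)=\mathbf t$; $\models^\xi_p\bullet A$ iff $\models^\xi_q A$ for all $q$ with $p\rhd q$; $\models^\xi_p A\to B$ iff for all $q$ with $pRq$, $\models^\xi_q A$ implies $\models^\xi_q B$; $\models^\xi_p\mu X.A$ iff $\models^\xi_p A[\mu X.A/X]$. *)

theory Defs
  imports Main
begin

section \<open>Type expressions (de Bruijn representation, so alpha-convertible expressions are identical)\<close>

text \<open>TV i: type variable (de Bruijn index; indices not bound by an enclosing Mu are the free
  type variables X, Y, ...).  Mu a: the binder mu X. a, where X is index 0 in a.\<close>

datatype ty = TV nat | Arr ty ty | Bul ty | Mu ty

fun lift :: "nat \<Rightarrow> ty \<Rightarrow> ty" where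
  "lift k (TV i) = (if i < k then TV i else TV (Suc i))"
| "lift k (Arr a b) = Arr (lift k a) (lift k b)"
| "lift k (Bul a) = Bul (lift k a)"
| "lift k (Mu a) = Mu (lift (Suc k) a)"

fun subst :: "ty \<Rightarrow> nat \<Rightarrow> ty \<Rightarrow> ty" where
  "subst (TV i) k u = (if i < k then TV i else if i = k then u else TV (i - 1))"
| "subst (Arr a b) k u = Arr (subst a k u) (subst b k u)"
| "subst (Bul a) k u = Bul (subst a k u)"
| "subst (Mu a) k u = Mu (subst a (Suc k) (lift 0 u))"

definition unfold :: "ty \<Rightarrow> ty" where
  "unfold a = subst a 0 (Mu a)"

definition inst :: "ty \<Rightarrow> nat \<Rightarrow> ty" where
  "inst a X = subst a 0 (TV X)"

fun ftv :: "ty \<Rightarrow> nat set" where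
  "ftv (TV i) = {i}"
| "ftv (Arr a b) = ftv a \<union> ftv b"
| "ftv (Bul a) = ftv a"
| "ftv (Mu a) = (\<lambda>i. i - 1) ` (ftv a - {0})"

definition Top :: ty where
  "Top = Mu (Bul (TV 0))"

fun bullets :: "nat \<Rightarrow> ty \<Rightarrow> ty" where
  "bullets 0 a = a"
| "bullets (Suc n) a = Bul (bullets n a)"

fun tail :: "ty \<Rightarrow> ty" where
  "tail (TV i) = TV i"
| "tail (Arr a b) = tail b"
| "tail (Bul a) = Bul (tail a)"
| "tail (Mu a) = Mu (tail a)"

text \<open>Checking the top-variant condition on a tail
  bullet^m0 mu X1. bullet^m1 ... mu Xn. bullet^mn Y.
  The list records, for each enclosing Mu of the tail (innermost first), whether at least one
  bullet occurs after that binder.  Y = TV j refers to the (j+1)-th innermost binder, which is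
  automatically the innermost binder of that name (X_i not in {X_(i+1),...,X_n}).\<close>
fun tv_aux :: "bool list \<Rightarrow> ty \<Rightarrow> bool" where
  "tv_aux bs (TV j) = (j < length bs \<and> bs ! j)"
| "tv_aux bs (Arr a b) = False"
| "tv_aux bs (Bul a) = tv_aux (map (\<lambda>_. True) bs) a"
| "tv_aux bs (Mu a) = tv_aux (False # bs) a"

definition topv :: "ty \<Rightarrow> bool" where
  "topv A = tv_aux [] (tail A)"

fun proper :: "nat \<Rightarrow> ty \<Rightarrow> bool" where
  "proper k (TV i) = (i \<noteq> k)"
| "proper k (Bul a) = True"
| "proper k (Arr a b) = ((proper k a \<and> proper k b) \<or> topv b)"
| "proper k (Mu a) = (proper (Suc k) a \<or> topv (Mu a))"

inductive wf :: "ty \<Rightarrow> bool" where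
  wf_TV: "wf (TV i)"
| wf_Arr: "wf a \<Longrightarrow> wf b \<Longrightarrow> wf (Arr a b)"
| wf_Bul: "wf a \<Longrightarrow> wf (Bul a)"
| wf_Mu: "wf a \<Longrightarrow> proper 0 a \<Longrightarrow> wf (Mu a)"

inductive sim :: "ty \<Rightarrow> ty \<Rightarrow> bool" where
  sim_refl: "wf A \<Longrightarrow> sim A A"
| sim_sym: "sim A B \<Longrightarrow> sim B A"
| sim_trans: "sim A B \<Longrightarrow> sim B C \<Longrightarrow> sim A C"
| sim_Bul: "sim A B \<Longrightarrow> sim (Bul A) (Bul B)"
| sim_Arr: "sim A C \<Longrightarrow> sim B D \<Longrightarrow> sim (Arr A B) (Arr C D)"
| sim_ArrTop: "wf A \<Longrightarrow> sim (Arr A Top) Top"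
| sim_unfold: "wf (Mu A) \<Longrightarrow> sim (Mu A) (unfold A)"
| sim_fix: "sim A (subst C 0 A) \<Longrightarrow> wf C \<Longrightarrow> proper 0 C \<Longrightarrow> sim A (Mu C)"
| sim_L: "wf A \<Longrightarrow> wf B \<Longrightarrow> sim (Bul (Arr A B)) (Arr (Bul A) (Bul B))"

definition ftvs :: "(nat \<times> nat) set \<Rightarrow> nat set" where
  "ftvs g = fst ` g \<union> snd ` g"

definition wfg :: "(nat \<times> nat) set \<Rightarrow> bool" where
  "wfg g \<longleftrightarrow> finite g \<and> (\<forall>p\<in>g. fst p \<noteq> snd p) \<and>
     (\<forall>p\<in>g. \<forall>q\<in>g. p \<noteq> q \<longrightarrow> {fst p, snd p} \<inter> {fst q, snd q} = {})"

inductive sub :: "(nat \<times> nat) set \<Rightarrow> ty \<Rightarrow> ty \<Rightarrow> bool" where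
  sub_ax: "wfg (insert (X, Y) g) \<Longrightarrow> sub (insert (X, Y) g) (TV X) (TV Y)"
| sub_top: "wfg g \<Longrightarrow> wf A \<Longrightarrow> sub g A Top"
| sub_sim: "wfg g \<Longrightarrow> sim A B \<Longrightarrow> sub g A B"
| sub_trans: "sub g1 A B \<Longrightarrow> sub g2 B C \<Longrightarrow> wfg (g1 \<union> g2) \<Longrightarrow> sub (g1 \<union> g2) A C"
| sub_Bul: "sub g A B \<Longrightarrow> sub g (Bul A) (Bul B)"
| sub_Arr: "sub g1 A' A \<Longrightarrow> sub g2 B B' \<Longrightarrow> wfg (g1 \<union> g2) \<Longrightarrow>
     sub (g1 \<union> g2) (Arr A B) (Arr A' B')"
| sub_Mu: "sub (insert (X, Y) g) (inst A X) (inst B Y) \<Longrightarrow> wfg (insert (X, Y) g) \<Longrightarrow>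
     X \<noteq> Y \<Longrightarrow> X \<notin> ftvs g \<union> ftv (Mu A) \<union> ftv (Mu B) \<Longrightarrow>
     Y \<notin> ftvs g \<union> ftv (Mu A) \<union> ftv (Mu B) \<Longrightarrow>
     wf A \<Longrightarrow> wf B \<Longrightarrow> proper 0 A \<Longrightarrow> proper 0 B \<Longrightarrow> sub g (Mu A) (Mu B)"
| sub_approx: "wfg g \<Longrightarrow> wf A \<Longrightarrow> sub g A (Bul A)"

definition subty :: "ty \<Rightarrow> ty \<Rightarrow> bool" where
  "subty A B = sub {} A B"

datatype lterm = LV nat | Lam nat lterm | App lterm lterm

type_synonym ctx = "nat \<Rightarrow> ty option"

definition wfctx :: "ctx \<Rightarrow> bool" where
  "wfctx G \<longleftrightarrow> finite (dom G) \<and> (\<forall>A\<in>ran G. wf A)"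

definition bulctx :: "ctx \<Rightarrow> ctx" where
  "bulctx G = map_option Bul \<circ> G"

definition compat :: "ctx \<Rightarrow> ctx \<Rightarrow> bool" where
  "compat G1 G2 \<longleftrightarrow> (\<forall>x\<in>dom G1 \<inter> dom G2. G1 x = G2 x)"

inductive has_type :: "ctx \<Rightarrow> lterm \<Rightarrow> ty \<Rightarrow> bool" where
  typ_var: "wfctx G \<Longrightarrow> G x = Some A \<Longrightarrow> has_type G (LV x) A"
| typ_shift: "has_type (bulctx G) M (Bul A) \<Longrightarrow> has_type G M A"
| typ_top: "wfctx G \<Longrightarrow> has_type G M Top"
| typ_sub: "has_type G M A \<Longrightarrow> subty A B \<Longrightarrow> has_type G M B"
| typ_lam: "G x = None \<or> G x = Some A \<Longrightarrow> has_type (G(x \<mapsto> A)) M B \<Longrightarrow> has_type G (Lam x M) (Arr A B)"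
| typ_app: "has_type G1 M (Arr A B) \<Longrightarrow> has_type G2 N A \<Longrightarrow> compat G1 G2 \<Longrightarrow> has_type (G1 ++ G2) (App M N) B"

definition wfset :: "ty set \<Rightarrow> bool" where
  "wfset G \<longleftrightarrow> finite G \<and> (\<forall>A\<in>G. wf A)"

inductive la :: "ty set \<Rightarrow> ty \<Rightarrow> bool" where
  la_assump: "wfset G \<Longrightarrow> wf A \<Longrightarrow> la (insert A G) A"
| la_nec: "la G1 A \<Longrightarrow> wfset G2 \<Longrightarrow> la (Bul ` G1 \<union> G2) (Bul A)"
| la_4: "la G (Bul A) \<Longrightarrow> la G (Bul (Bul A))"
| la_ArrI: "la (insert A G) B \<Longrightarrow> la G (Arr A B)"
| la_ArrE: "la G1 (Arr A B) \<Longrightarrow> la G2 A \<Longrightarrow> la (G1 \<union> G2) B"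
| la_fold: "la G (unfold A) \<Longrightarrow> wf (Mu A) \<Longrightarrow> la G (Mu A)"
| la_unfold: "la G (Mu A) \<Longrightarrow> la G (unfold A)"
| la_L: "la G (Arr (Bul A) (Bul B)) \<Longrightarrow> la G (Bul (Arr A B))"
| la_approx: "la G A \<Longrightarrow> la G (Bul A)"

definition la_frame :: "'w set \<Rightarrow> ('w \<Rightarrow> 'w \<Rightarrow> bool) \<Rightarrow> ('w \<Rightarrow> 'w \<Rightarrow> bool) \<Rightarrow> bool" where
  "la_frame W S R \<longleftrightarrow>
     W \<noteq> {} \<and>
     (\<forall>p q. S p q \<longrightarrow> p \<in> W \<and> q \<in> W) \<and>
     (\<forall>p q. R p q \<longrightarrow> p \<in> W \<and> q \<in> W) \<and>
     \<not> (\<exists>f :: nat \<Rightarrow> 'w. \<forall>n. S (f n) (f (Suc n))) \<and>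
     (\<forall>p\<in>W. R p p) \<and>
     (\<forall>p q r. R p q \<longrightarrow> R q r \<longrightarrow> R p r) \<and>
     (\<forall>p q r. R p q \<longrightarrow> S q r \<longrightarrow> S p r) \<and>
     (\<forall>p q. S p q \<longrightarrow> R p q) \<and>
     (\<forall>p q q'. S p q \<longrightarrow> R q q' \<longrightarrow> (\<exists>r. R p r \<and> S r q' \<and> (\<forall>s. S r s \<longrightarrow> R q' s)))"

definition hereditary :: "('w \<Rightarrow> 'w \<Rightarrow> bool) \<Rightarrow> (nat \<Rightarrow> 'w \<Rightarrow> bool) \<Rightarrow> bool" where
  "hereditary R \<xi> \<longleftrightarrow> (\<forall>X p q. R p q \<longrightarrow> \<xi> X p \<longrightarrow> \<xi> X q)"

text \<open>The clauses defining forcing (for worlds in W and type expressions); F is required to be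
  False elsewhere so that the clauses determine F uniquely.\<close>
definition forcing_clauses :: "'w set \<Rightarrow> ('w \<Rightarrow> 'w \<Rightarrow> bool) \<Rightarrow> ('w \<Rightarrow> 'w \<Rightarrow> bool) \<Rightarrow>
    (nat \<Rightarrow> 'w \<Rightarrow> bool) \<Rightarrow> ('w \<Rightarrow> ty \<Rightarrow> bool) \<Rightarrow> bool" where
  "forcing_clauses W S R \<xi> F \<longleftrightarrow>
     (\<forall>p A. F p A \<longrightarrow> p \<in> W \<and> wf A) \<and>
     (\<forall>p\<in>W. \<forall>A. wf A \<longrightarrow>
        F p A = (topv A \<or>
          (case A of
             TV X \<Rightarrow> \<xi> X p
           | Bul B \<Rightarrow> (\<forall>q. S p q \<longrightarrow> F q B)
           | Arr B C \<Rightarrow> (\<forall>q. R p q \<longrightarrow> F q B \<longrightarrow> F q C)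
           | Mu B \<Rightarrow> F p (unfold B))))"

definition forces :: "'w set \<Rightarrow> ('w \<Rightarrow> 'w \<Rightarrow> bool) \<Rightarrow> ('w \<Rightarrow> 'w \<Rightarrow> bool) \<Rightarrow>
    (nat \<Rightarrow> 'w \<Rightarrow> bool) \<Rightarrow> 'w \<Rightarrow> ty \<Rightarrow> bool" where
  "forces W S R \<xi> = (THE F. forcing_clauses W S R \<xi> F)"

end

theory Submission
  imports Defs "HOL-Library.Countable"
begin

text \<open>
  Soundness of the logic and of subtyping is a well-founded induction on worlds, where equality of
  the values of a variable in proper position is only needed one step later.

  Completeness goes through goal-directed search.  Up to \<open>\<simeq>\<close>, every type that is not a top-variant has
  the shape \<open>A\<^sub>1 \<rightarrow> \<dots> \<rightarrow> A\<^sub>n \<rightarrow> \<bullet>\<^sup>k X\<close>, so a goal is eventually a variable under bullets, to be proved by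
  focusing on a hypothesis.  If goals with at least \<open>K\<close> bullets are taken for granted, the search
  states \<open>(k, \<Gamma>)\<close> with \<open>k < K\<close>, ordered componentwise, form an LA-frame in which the state
  forces the hypotheses in \<open>\<Gamma>\<close>, and forces \<open>A\<close> only if the search for \<open>\<bullet>\<^sup>k A\<close> from \<open>\<Gamma>\<close> succeeds.
  Conversely, Loeb's rule allows one to assume \<open>\<bullet>\<^sup>k\<^sup>+\<^sup>1 X\<close> while proving \<open>\<bullet>\<^sup>k X\<close>; hence only the first goal for each variable can increase the number
  of bullets, and by an amount bounded on the finite set of types reachable by unfolding.  For
  large \<open>K\<close> the limit is thus never reached and a successful search yields a derivation.

  A further layer of worlds below the search states shows that the shift rule is admissible in
  the logic, which yields the passage from typings to derivations.
\<close>

subsection \<open>Substitution\<close>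

lemma lift_lift: "i \<le> k \<Longrightarrow> lift (Suc k) (lift i a) = lift i (lift k a)"
  by (induction a arbitrary: i k) auto

lemma subst_lift [simp]: "subst (lift k a) k u = a"
  by (induction a arbitrary: k u) auto

lemma lift_subst: "i \<le> k \<Longrightarrow> lift i (subst a k u) = subst (lift i a) (Suc k) (lift i u)"
  by (induction a arbitrary: i k u) (auto simp: lift_lift)

lemma subst_subst:
  "i \<le> k \<Longrightarrow> subst (subst a (Suc k) (lift i u)) i (subst v k u) = subst (subst a i v) k u"
proof (induction a arbitrary: i k u v)
  case (Mu a)
  then show ?case
    using lift_lift[of 0 i u] lift_subst[of 0 k v u] Mu.IH[of "Suc i" "Suc k" "lift 0 u" "lift 0 v"]
    by simp
qed auto

text \<open>Lets a substitution pass through an unfolding. Inductions that replace a recursive type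
  by its unfolding need it in their \<open>Mu\<close> case.\<close>

lemma unfold_subst: "unfold (subst a (Suc k) (lift 0 u)) = subst (unfold a) k u"
  using subst_subst[of 0 k a u "Mu a"] by (simp add: unfold_def)

lemma ftv_Mu_iff: "i \<in> ftv (Mu a) \<longleftrightarrow> Suc i \<in> ftv a"
proof -
  have "i = j - 1 \<longleftrightarrow> j = Suc i" if "j \<noteq> 0" for j using that by auto
  then show ?thesis by (auto simp: image_iff)
qed

lemma ftv_lift: "i \<in> ftv (lift k u) \<Longrightarrow> i < k \<and> i \<in> ftv u \<or> k < i \<and> i - 1 \<in> ftv u"
proof (induction u arbitrary: i k)
  case (Mu u)
  then have "Suc i \<in> ftv (lift (Suc k) u)" by (simp only: lift.simps ftv_Mu_iff)
  from Mu.IH[OF this] show ?case unfolding ftv_Mu_iff by auto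
qed (auto split: if_splits)

lemma ftv_subst:
  "i \<in> ftv (subst a k u) \<Longrightarrow>
    i < k \<and> i \<in> ftv a \<or> k \<le> i \<and> Suc i \<in> ftv a \<or> k \<in> ftv a \<and> i \<in> ftv u"
proof (induction a arbitrary: i k u)
  case (Mu a)
  then have "Suc i \<in> ftv (subst a (Suc k) (lift 0 u))" by (simp only: subst.simps ftv_Mu_iff)
  from Mu.IH[OF this] ftv_lift[of "Suc i" 0 u] show ?case
    unfolding ftv_Mu_iff by auto
next
  case (Arr a b)
  then show ?case using Arr.IH(1)[of i k u] Arr.IH(2)[of i k u] by (simp, blast)
qed (auto split: if_splits)

lemma ftv_unfold: "ftv (unfold a) \<subseteq> ftv (Mu a)"
proof
  fix i assume "i \<in> ftv (unfold a)"
  then show "i \<in> ftv (Mu a)"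
    unfolding unfold_def ftv_Mu_iff using ftv_subst[of i a 0 "Mu a"] ftv_Mu_iff[of i a] by auto
qed

subsection \<open>Tails and top-variants\<close>

text \<open>The top-variant test for an open body: \<open>bs\<close> lists, innermost first, the
  binders already passed on the tail, an entry being \<open>True\<close> once a bullet has followed
  that binder.\<close>

abbreviation tv :: "bool list \<Rightarrow> ty \<Rightarrow> bool" where
  "tv bs a \<equiv> tv_aux bs (tail a)"

lemma topv_simps [simp]:
  "\<not> topv (TV i)" "topv (Arr a b) \<longleftrightarrow> topv b" "topv (Bul a) \<longleftrightarrow> topv a"
  by (simp_all add: topv_def)

lemma topv_Top: "topv Top"
  by (simp add: topv_def Top_def)

lemma tv_append: "tv bs a \<Longrightarrow> tv (bs @ cs) a"
proof (induction a arbitrary: bs cs)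
  case (Mu a)
  then show ?case using Mu.IH[of "False # bs" cs] by simp
qed (auto simp: nth_append)

lemma tv_mono: "list_all2 (\<longrightarrow>) bs cs \<Longrightarrow> tv bs a \<Longrightarrow> tv cs a"
proof (induction a arbitrary: bs cs)
  case (TV i)
  then show ?case by (auto simp: list_all2_conv_all_nth)
next
  case (Bul a)
  have "list_all2 (\<longrightarrow>) (map (\<lambda>_. True) bs) (map (\<lambda>_. True) cs)"
    using Bul.prems(1) by (auto simp: list_all2_conv_all_nth)
  with Bul show ?case by auto
next
  case (Mu a)
  then show ?case using Mu.IH[of "False # bs" "False # cs"] by auto
qed auto

lemma tv_lift: "tv (bs @ cs) a \<Longrightarrow> tv (bs @ b # cs) (lift (length bs) a)"
proof (induction a arbitrary: bs cs b)
  case (TV i)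
  then show ?case by (auto simp: nth_append Suc_diff_le)
next
  case (Bul a)
  then show ?case using Bul.IH[of "map (\<lambda>_. True) bs" "map (\<lambda>_. True) cs"] by auto
next
  case (Mu a)
  then show ?case using Mu.IH[of "False # bs" cs] by auto
qed auto

text \<open>If the tail of \<open>a\<close> ends in the substituted variable, the tail of
  \<open>u\<close> takes over, so the entry \<open>b\<close> may be arbitrary. Bullets crossed on
  the way only turn entries to \<open>True\<close>, which preserves the test for
  \<open>u\<close>.\<close>

lemma tv_subst:
  "tv (bs @ b # cs) a \<Longrightarrow> tv (bs @ cs) u \<Longrightarrow> tv (bs @ cs) (subst a (length bs) u)"
proof (induction a arbitrary: bs b cs u)
  case (TV i)
  then show ?case by (auto simp: nth_append nth_Cons' split: if_splits)
next
  case (Bul a)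
  have "list_all2 (\<longrightarrow>) (bs @ cs) (map (\<lambda>_. True) (bs @ cs))"
    by (auto simp: list_all2_conv_all_nth nth_append)
  with Bul.prems(2) have "tv (map (\<lambda>_. True) (bs @ cs)) u" by (blast intro: tv_mono)
  with Bul show ?case
    using Bul.IH[of "map (\<lambda>_. True) bs" True "map (\<lambda>_. True) cs" u] by auto
next
  case (Mu a)
  then show ?case
    using Mu.IH[of "False # bs" b cs "lift 0 u"] tv_lift[of "[]" "bs @ cs" u False] by auto
qed auto

lemma tv_subst_free: "tv bs a \<Longrightarrow> length bs \<le> k \<Longrightarrow> tv bs (subst a k u)"
  by (induction a arbitrary: bs k u) auto

lemma topv_subst: "topv a \<Longrightarrow> topv (subst a k u)"
  unfolding topv_def by (rule tv_subst_free) simp_all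

lemma tv_lift_free: "tv bs a \<Longrightarrow> length bs \<le> k \<Longrightarrow> tv bs (lift k a)"
  by (induction a arbitrary: bs k) auto

lemma topv_lift: "topv a \<Longrightarrow> topv (lift k a)"
  unfolding topv_def by (rule tv_lift_free) simp_all

lemma topv_unfold: "topv (Mu a) \<Longrightarrow> topv (unfold a)"
  unfolding topv_def unfold_def using tv_subst[of "[]" False "[]" a "Mu a"] by simp

section \<open>The variable at the end of a tail, and measures along the tail\<close>

fun tail_var :: "nat \<Rightarrow> ty \<Rightarrow> bool" where
  "tail_var k (TV i) \<longleftrightarrow> i = k"
| "tail_var k (Arr a b) \<longleftrightarrow> tail_var k b"
| "tail_var k (Bul a) \<longleftrightarrow> tail_var k a"
| "tail_var k (Mu a) \<longleftrightarrow> tail_var (Suc k) a"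

fun tail_bul :: "ty \<Rightarrow> nat" where
  "tail_bul (TV i) = 0"
| "tail_bul (Arr a b) = tail_bul b"
| "tail_bul (Bul a) = Suc (tail_bul a)"
| "tail_bul (Mu a) = tail_bul a"

text \<open>The measure for inductions that follow a goal to its final variable. It ignores
  antecedents and decreases under unfolding as long as the tail does not end in the bound
  variable.\<close>

fun tail_size :: "ty \<Rightarrow> nat" where
  "tail_size (TV i) = 0"
| "tail_size (Arr a b) = Suc (tail_size b)"
| "tail_size (Bul a) = Suc (tail_size a)"
| "tail_size (Mu a) = Suc (tail_size a)"

lemma tail_subst_other:
  assumes "\<not> tail_var k a"
  shows "tail_size (subst a k u) = tail_size a" "tail_bul (subst a k u) = tail_bul a"
  using assms by (induction a arbitrary: k u) auto

lemma tail_var_unique: "tail_var k a \<Longrightarrow> tail_var j a \<Longrightarrow> j = k"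
  by (induction a arbitrary: j k) auto

lemma tail_var_subst: "tail_var (Suc (j + k)) a \<Longrightarrow> tail_var (j + k) (subst a j u)"
proof (induction a arbitrary: j u)
  case (Mu a)
  then show ?case using Mu.IH[of "Suc j"] by simp
qed auto

lemma tv_tail_var: "tail_var k a \<Longrightarrow> k < length bs \<Longrightarrow> bs ! k \<Longrightarrow> tv bs a"
  by (induction a arbitrary: k bs) auto

text \<open>Properness of the final variable has two sources: a bullet before it on the tail, which
  sets its entry to \<open>True\<close>, or a subexpression that is a top-variant on its own. Hence
  the entries of \<open>bs\<close> do not matter.\<close>

lemma tv_tail_var_proper: "tail_var k a \<Longrightarrow> proper k a \<Longrightarrow> k < length bs \<Longrightarrow> tv bs a"
proof (induction a arbitrary: k bs)
  case (Arr a b)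
  then show ?case using tv_append[of "[]" b bs] by (auto simp: topv_def)
next
  case (Bul a)
  then show ?case using tv_tail_var[of k a "map (\<lambda>_. True) bs"] by auto
next
  case (Mu a)
  then show ?case using tv_append[of "[]" "Mu a" bs] by (auto simp: topv_def)
qed auto

lemma tv_tail_bul: "tail_var k a \<Longrightarrow> tv bs a \<Longrightarrow> k < length bs \<Longrightarrow> \<not> bs ! k \<Longrightarrow> 0 < tail_bul a"
  by (induction a arbitrary: k bs) auto

lemma topv_tail_var_0: "topv (Mu a) \<Longrightarrow> tail_var 0 a \<Longrightarrow> 0 < tail_bul a"
  by (auto simp: topv_def intro: tv_tail_bul)

text \<open>Otherwise properness would guard the final variable by a bullet and make the type a
  top-variant. This is what makes repeated unfolding along the tail terminate.\<close>

lemma not_tail_var_0: "wf (Mu a) \<Longrightarrow> \<not> topv (Mu a) \<Longrightarrow> \<not> tail_var 0 a"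
  by (auto simp: topv_def elim: wf.cases dest: tv_tail_var_proper[of 0 a "[False]"])

subsection \<open>Properness and well-formedness\<close>

lemma proper_lift_less: "j < k \<Longrightarrow> proper j a \<Longrightarrow> proper j (lift k a)"
proof (induction a arbitrary: j k)
  case (Mu a)
  then show ?case using topv_lift[of "Mu a" k] by auto
qed (auto intro: topv_lift)

lemma proper_lift: "k \<le> j \<Longrightarrow> proper j a \<Longrightarrow> proper (Suc j) (lift k a)"
proof (induction a arbitrary: j k)
  case (Mu a)
  then show ?case using topv_lift[of "Mu a" k] by auto
qed (auto intro: topv_lift)

lemma proper_lift_same: "proper k (lift k a)"
  by (induction a arbitrary: k) auto

lemma proper_subst_less: "j < k \<Longrightarrow> proper j a \<Longrightarrow> proper j u \<Longrightarrow> proper j (subst a k u)"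
proof (induction a arbitrary: j k u)
  case (Mu a)
  then show ?case
    using topv_subst[of "Mu a" k u] proper_lift[of 0 j u] by auto
qed (auto intro: topv_subst)

lemma proper_subst: "k \<le> j \<Longrightarrow> proper (Suc j) a \<Longrightarrow> proper j u \<Longrightarrow> proper j (subst a k u)"
proof (induction a arbitrary: j k u)
  case (Mu a)
  then show ?case
    using topv_subst[of "Mu a" k u] proper_lift[of 0 j u] by auto
qed (auto intro: topv_subst)

lemma wf_simps [simp]:
  "wf (TV i)" "wf (Arr a b) \<longleftrightarrow> wf a \<and> wf b" "wf (Bul a) \<longleftrightarrow> wf a"
  by (auto intro: wf.intros elim: wf.cases)

lemma wf_Mu_iff: "wf (Mu a) \<longleftrightarrow> wf a \<and> proper 0 a"
  by (auto intro: wf.intros elim: wf.cases)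

lemma wf_Top [simp]: "wf Top"
  by (simp add: Top_def wf_Mu_iff)

lemma wf_lift: "wf a \<Longrightarrow> wf (lift k a)"
  by (induction a arbitrary: k) (auto simp: wf_Mu_iff proper_lift_less)

lemma wf_subst: "wf a \<Longrightarrow> wf u \<Longrightarrow> wf (subst a k u)"
  by (induction a arbitrary: k u)
     (auto simp: wf_Mu_iff wf_lift proper_lift_same intro: proper_subst_less)

lemma wf_unfold: "wf (Mu a) \<Longrightarrow> wf (unfold a)"
  unfolding unfold_def by (auto simp: wf_Mu_iff intro: wf_subst)

lemma proper_unfold: "proper k (Mu a) \<Longrightarrow> \<not> topv (Mu a) \<Longrightarrow> proper k (unfold a)"
  unfolding unfold_def by (auto intro: proper_subst)

text \<open>Unfolding decreases this rank, although it may enlarge the expression: a substitution into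
  proper positions only reaches subexpressions of rank 0.\<close>

fun rank :: "ty \<Rightarrow> nat" where
  "rank (TV i) = 0"
| "rank (Bul a) = 0"
| "rank (Arr a b) = (if topv b then 0 else Suc (max (rank a) (rank b)))"
| "rank (Mu a) = (if topv (Mu a) then 0 else Suc (rank a))"

lemma rank_subst: "proper k a \<Longrightarrow> rank (subst a k u) \<le> rank a"
proof (induction a arbitrary: k u)
  case (Arr a b)
  then show ?case using topv_subst[of b k u] by (auto intro: max.coboundedI1 max.coboundedI2)
next
  case (Mu a)
  then show ?case using topv_subst[of "Mu a" k u] by auto
qed auto

lemma rank_unfold: "wf (Mu a) \<Longrightarrow> \<not> topv (Mu a) \<Longrightarrow> rank (unfold a) < rank (Mu a)"
  unfolding unfold_def using rank_subst[of 0 a "Mu a"] by (auto simp: wf_Mu_iff less_Suc_eq_le)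

lemma tail_size_unfold:
  assumes "\<not> tail_var 0 a"
  shows "tail_size (unfold a) < tail_size (Mu a)" "tail_bul (unfold a) = tail_bul (Mu a)"
  using tail_subst_other[OF assms] by (simp_all add: unfold_def)

subsection \<open>Forcing\<close>

definition force_rel :: "('w \<Rightarrow> 'w \<Rightarrow> bool) \<Rightarrow> (('w \<times> ty) \<times> ('w \<times> ty)) set" where
  "force_rel S = {((q, B), (p, A)). S p q \<or> (\<forall>r. S q r \<longrightarrow> S p r) \<and> rank B < rank A}"

definition force_step :: "'w set \<Rightarrow> ('w \<Rightarrow> 'w \<Rightarrow> bool) \<Rightarrow> ('w \<Rightarrow> 'w \<Rightarrow> bool) \<Rightarrow>
    (nat \<Rightarrow> 'w \<Rightarrow> bool) \<Rightarrow> ('w \<times> ty \<Rightarrow> bool) \<Rightarrow> 'w \<times> ty \<Rightarrow> bool" where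
  "force_step W S R \<xi> f = (\<lambda>(p, A). p \<in> W \<and> wf A \<and> (topv A \<or>
      (case A of
         TV X \<Rightarrow> \<xi> X p
       | Bul B \<Rightarrow> (\<forall>q. S p q \<longrightarrow> f (q, B))
       | Arr B C \<Rightarrow> (\<forall>q. R p q \<longrightarrow> f (q, B) \<longrightarrow> f (q, C))
       | Mu B \<Rightarrow> f (p, unfold B))))"

locale frame =
  fixes W :: "'w set" and S R :: "'w \<Rightarrow> 'w \<Rightarrow> bool"
  assumes la_frame: "la_frame W S R"
begin

lemma frame_conditions:
  "\<forall>p q. S p q \<longrightarrow> p \<in> W \<and> q \<in> W"
  "\<forall>p q. R p q \<longrightarrow> p \<in> W \<and> q \<in> W"
  "\<not> (\<exists>f :: nat \<Rightarrow> 'w. \<forall>n. S (f n) (f (Suc n)))"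
  "\<forall>p\<in>W. R p p"
  "\<forall>p q r. R p q \<longrightarrow> R q r \<longrightarrow> R p r"
  "\<forall>p q r. R p q \<longrightarrow> S q r \<longrightarrow> S p r"
  "\<forall>p q. S p q \<longrightarrow> R p q"
  "\<forall>p q q'. S p q \<longrightarrow> R q q' \<longrightarrow> (\<exists>r. R p r \<and> S r q' \<and> (\<forall>s. S r s \<longrightarrow> R q' s))"
  by (insert la_frame, unfold la_frame_def, elim conjE, assumption)+

lemma S_W: "S p q \<Longrightarrow> p \<in> W" "S p q \<Longrightarrow> q \<in> W"
  using frame_conditions(1) by blast+

lemma R_W: "R p q \<Longrightarrow> p \<in> W" "R p q \<Longrightarrow> q \<in> W"
  using frame_conditions(2) by blast+

lemma R_refl: "p \<in> W \<Longrightarrow> R p p"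
  using frame_conditions(4) by blast

lemma R_trans: "R p q \<Longrightarrow> R q r \<Longrightarrow> R p r"
  using frame_conditions(5) by blast

lemma R_S: "R p q \<Longrightarrow> S q r \<Longrightarrow> S p r"
  using frame_conditions(6) by blast

lemma S_R: "S p q \<Longrightarrow> R p q"
  using frame_conditions(7) by blast

lemma S_R_lift: "S p q \<Longrightarrow> R q q' \<Longrightarrow> \<exists>r. R p r \<and> S r q' \<and> (\<forall>s. S r s \<longrightarrow> R q' s)"
  using frame_conditions(8) by blast

lemma S_R_S: "S p q \<Longrightarrow> R q r \<Longrightarrow> S p r"
  using S_R_lift R_S by blast

lemma S_trans: "S p q \<Longrightarrow> S q r \<Longrightarrow> S p r"
  using S_R R_S by blast

lemma wf_converse_S: "Wellfounded.wf {(q, p). S p q}"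
  unfolding wf_iff_no_infinite_down_chain using frame_conditions(3) by auto

lemma wf_force_rel: "Wellfounded.wf (force_rel S)"
proof -
  have acc: "(p, A) \<in> Wellfounded.acc (force_rel S)" for p A
    using wf_converse_S
  proof (induction p arbitrary: A rule: wf_induct_rule)
    case (less p)
    \<comment> \<open>Generalised to every \<open>p'\<close> whose successors are successors of
      \<open>p\<close>, because a step that lowers the rank may also change the world.\<close>
    have "(p', A) \<in> Wellfounded.acc (force_rel S)" if "\<forall>r. S p' r \<longrightarrow> S p r" for p' A
      using that
    proof (induction A arbitrary: p' rule: measure_induct_rule[of rank])
      case (less A)
      show ?case
      proof (rule accI)
        fix y assume "(y, (p', A)) \<in> force_rel S"
        then obtain q B where y: "y = (q, B)"
          and "S p' q \<or> (\<forall>r. S q r \<longrightarrow> S p' r) \<and> rank B < rank A"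
          by (cases y) (auto simp: force_rel_def)
        then consider "S p q" | "\<forall>r. S q r \<longrightarrow> S p r" "rank B < rank A" using less.prems by blast
        then show "y \<in> Wellfounded.acc (force_rel S)"
        proof cases
          case 1
          then show ?thesis using \<open>\<And>y A. (y, p) \<in> {(q, p). S p q} \<Longrightarrow> (y, A) \<in> Wellfounded.acc (force_rel S)\<close> y
            by simp
        next
          case 2
          then show ?thesis using less.IH y by simp
        qed
      qed
    qed
    then show ?case by blast
  qed
  then show ?thesis by (intro acc_wfI) auto
qed

text \<open>Recursive calls only go down in \<open>force_rel\<close>. Top-variants may have no
  smaller rank below them, but there the value does not depend on \<open>f\<close>. The fact serves
  both the recursion equation and uniqueness.\<close>

lemma force_step_cut:
  "force_step W S R \<xi> (cut f (force_rel S) (p, A)) (p, A) = force_step W S R \<xi> f (p, A)"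
proof (cases "p \<in> W \<and> wf A \<and> \<not> topv A")
  case True
  show ?thesis
  proof (cases A)
    case (TV X)
    then show ?thesis by (simp add: force_step_def)
  next
    case (Arr B C)
    have "((q, B), (p, A)) \<in> force_rel S \<and> ((q, C), (p, A)) \<in> force_rel S" if "R p q" for q
      using True R_S[OF that] by (auto simp: force_rel_def Arr)
    then show ?thesis by (simp add: force_step_def cut_def Arr cong: imp_cong)
  next
    case (Bul B)
    then show ?thesis by (simp add: force_step_def force_rel_def cut_def)
  next
    case (Mu B)
    have "((p, unfold B), (p, A)) \<in> force_rel S"
      using True rank_unfold[of B] unfolding force_rel_def Mu by blast
    then show ?thesis by (simp add: force_step_def cut_def Mu)
  qed
qed (auto simp: force_step_def)

definition Fw :: "(nat \<Rightarrow> 'w \<Rightarrow> bool) \<Rightarrow> 'w \<Rightarrow> ty \<Rightarrow> bool" where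
  "Fw \<xi> p A = wfrec (force_rel S) (force_step W S R \<xi>) (p, A)"

lemma Fw_eq: "Fw \<xi> p A = force_step W S R \<xi> (\<lambda>(p, A). Fw \<xi> p A) (p, A)"
proof -
  have "Fw \<xi> p A = force_step W S R \<xi> (cut (wfrec (force_rel S) (force_step W S R \<xi>)) (force_rel S) (p, A)) (p, A)"
    unfolding Fw_def by (rule wfrec[OF wf_force_rel])
  also have "\<dots> = force_step W S R \<xi> (wfrec (force_rel S) (force_step W S R \<xi>)) (p, A)"
    by (rule force_step_cut)
  also have "wfrec (force_rel S) (force_step W S R \<xi>) = (\<lambda>(p, A). Fw \<xi> p A)"
    by (auto simp: Fw_def)
  finally show ?thesis .
qed

lemma forcing_clauses_iff:
  "forcing_clauses W S R \<xi> F \<longleftrightarrow> (\<forall>p A. F p A = force_step W S R \<xi> (\<lambda>(p, A). F p A) (p, A))"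
  (is "?L \<longleftrightarrow> ?R")
proof
  assume L: ?L
  show ?R
  proof (intro allI)
    fix p A
    show "F p A = force_step W S R \<xi> (\<lambda>(p, A). F p A) (p, A)"
    proof (cases "p \<in> W \<and> wf A")
      case True
      with L have "F p A = (topv A \<or> (case A of
             TV X \<Rightarrow> \<xi> X p
           | Bul B \<Rightarrow> (\<forall>q. S p q \<longrightarrow> F q B)
           | Arr B C \<Rightarrow> (\<forall>q. R p q \<longrightarrow> F q B \<longrightarrow> F q C)
           | Mu B \<Rightarrow> F p (unfold B)))"
        unfolding forcing_clauses_def by blast
      then show ?thesis using True by (simp only:) (simp add: force_step_def split: ty.split)
    next
      case False
      with L have "\<not> F p A" unfolding forcing_clauses_def by blast
      then show ?thesis using False by (auto simp: force_step_def)
    qed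
  qed
next
  assume R: ?R
  show ?L
    unfolding forcing_clauses_def
  proof (intro conjI allI impI ballI)
    show "p \<in> W" "wf A" if "F p A" for p A
      using that by (subst (asm) R[rule_format]; simp add: force_step_def)+
    show "F p A = (topv A \<or> (case A of
             TV X \<Rightarrow> \<xi> X p
           | Bul B \<Rightarrow> (\<forall>q. S p q \<longrightarrow> F q B)
           | Arr B C \<Rightarrow> (\<forall>q. R p q \<longrightarrow> F q B \<longrightarrow> F q C)
           | Mu B \<Rightarrow> F p (unfold B)))" if "p \<in> W" "wf A" for p A
      using that by (subst R[rule_format]) (simp add: force_step_def split: ty.split)
  qed
qed

lemma forcing_clauses_unique:
  assumes "forcing_clauses W S R \<xi> F" "forcing_clauses W S R \<xi> G"
  shows "F = G"
proof -
  have "F p A = G p A" for p A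
  proof -
    have "(\<lambda>(p, A). F p A) pA = (\<lambda>(p, A). G p A) pA" for pA
      using wf_force_rel
    proof (induction pA rule: wf_induct_rule)
      case (less pA)
      obtain p A where pA: "pA = (p, A)" by (cases pA)
      have "cut (\<lambda>(p, A). F p A) (force_rel S) (p, A) = cut (\<lambda>(p, A). G p A) (force_rel S) (p, A)"
        using less by (auto simp: pA cut_def fun_eq_iff)
      then have "force_step W S R \<xi> (\<lambda>(p, A). F p A) (p, A) = force_step W S R \<xi> (\<lambda>(p, A). G p A) (p, A)"
        by (metis force_step_cut)
      then have "F p A = G p A"
        using iffD1[OF forcing_clauses_iff assms(1), THEN spec, THEN spec, of p A]
          iffD1[OF forcing_clauses_iff assms(2), THEN spec, THEN spec, of p A] by (rule box_equals[OF _ sym sym])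
      then show ?case by (simp add: pA)
    qed
    from this[of "(p, A)"] show ?thesis by simp
  qed
  then show ?thesis by (simp add: fun_eq_iff)
qed

lemma forces_clauses: "forcing_clauses W S R \<xi> (forces W S R \<xi>)"
proof -
  have *: "forcing_clauses W S R \<xi> (Fw \<xi>)"
    by (rule iffD2[OF forcing_clauses_iff]) (rule allI, rule allI, rule Fw_eq)
  show ?thesis
    unfolding forces_def
    by (rule theI[where a = "Fw \<xi>"]) (rule *, erule forcing_clauses_unique[OF _ *])
qed

abbreviation forced :: "(nat \<Rightarrow> 'w \<Rightarrow> bool) \<Rightarrow> 'w \<Rightarrow> ty \<Rightarrow> bool" where
  "forced \<equiv> forces W S R"

lemma forced_step: "forced \<xi> p A = force_step W S R \<xi> (\<lambda>(p, A). forced \<xi> p A) (p, A)"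
  by (rule iffD1[OF forcing_clauses_iff forces_clauses, THEN spec, THEN spec])

lemma forced_topv: "p \<in> W \<Longrightarrow> wf A \<Longrightarrow> topv A \<Longrightarrow> forced \<xi> p A"
  by (subst forced_step) (simp add: force_step_def)

lemma forced_TV: "p \<in> W \<Longrightarrow> forced \<xi> p (TV X) \<longleftrightarrow> \<xi> X p"
  by (subst forced_step) (simp add: force_step_def)

lemma forced_Bul: "p \<in> W \<Longrightarrow> wf A \<Longrightarrow> forced \<xi> p (Bul A) \<longleftrightarrow> (\<forall>q. S p q \<longrightarrow> forced \<xi> q A)"
  by (subst forced_step) (auto simp: force_step_def S_W intro: forced_topv)

lemma forced_Arr: "p \<in> W \<Longrightarrow> wf A \<Longrightarrow> wf B \<Longrightarrow>
    forced \<xi> p (Arr A B) \<longleftrightarrow> (\<forall>q. R p q \<longrightarrow> forced \<xi> q A \<longrightarrow> forced \<xi> q B)"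
  by (subst forced_step) (auto simp: force_step_def R_W intro: forced_topv)

lemma forced_Mu: "p \<in> W \<Longrightarrow> wf (Mu A) \<Longrightarrow> forced \<xi> p (Mu A) \<longleftrightarrow> forced \<xi> p (unfold A)"
  by (subst forced_step) (auto simp: force_step_def intro: forced_topv wf_unfold topv_unfold)

section \<open>Heredity of forcing, and its dependence on valuations and substituted types\<close>

lemma forced_hereditary:
  assumes "hereditary R \<xi>" "wf A" "R p q" "forced \<xi> p A"
  shows "forced \<xi> q A"
  using assms(2-4)
proof (induction A rule: measure_induct_rule[of rank])
  case (less A)
  then have W: "p \<in> W" "q \<in> W" by (auto dest: R_W)
  show ?case
  proof (cases "topv A")
    case True
    then show ?thesis using less.prems W by (simp add: forced_topv)
  next
    case False
    show ?thesis
    proof (cases A)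
      case (TV X)
      then show ?thesis using less.prems W assms(1) by (auto simp: forced_TV hereditary_def)
    next
      case (Arr B C)
      then show ?thesis using less.prems W R_trans by (auto simp: forced_Arr)
    next
      case (Bul B)
      then show ?thesis using less.prems W R_S by (auto simp: forced_Bul)
    next
      case (Mu B)
      with False less.prems W less.IH[of "unfold B"] show ?thesis
        by (auto simp: forced_Mu wf_unfold rank_unfold simp del: rank.simps)
    qed
  qed
qed

lemma forced_induct [case_names step]:
  assumes step: "\<And>p A. (\<And>q B. S p q \<Longrightarrow> P q B) \<Longrightarrow> (\<And>q B. R p q \<Longrightarrow> rank B < rank A \<Longrightarrow> P q B) \<Longrightarrow> P p A"
  shows "P p A"
proof -
  have "(\<lambda>(p, A). P p A) pA" for pA
    using wf_force_rel
  proof (induction pA rule: wf_induct_rule)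
    case (less pA)
    obtain p A where pA: "pA = (p, A)" by (cases pA)
    have "P p A"
    proof (rule step)
      show "P q B" if "S p q" for q B
        using less[of "(q, B)"] that by (auto simp: pA force_rel_def)
      show "P q B" if "R p q" "rank B < rank A" for q B
        using less[of "(q, B)"] that R_S by (auto simp: pA force_rel_def)
    qed
    then show ?case by (simp add: pA)
  qed
  from this[of "(p, A)"] show ?thesis by simp
qed

lemma forced_cong_valuation:
  assumes "\<And>X q. X \<in> ftv A \<Longrightarrow> \<xi> X q = \<xi>' X q" and "wf A" "p \<in> W"
  shows "forced \<xi> p A \<longleftrightarrow> forced \<xi>' p A"
  using assms
proof (induction p A rule: forced_induct)
  case (step p A)
  show ?case
  proof (cases "topv A")
    case True
    then show ?thesis using step.prems by (simp add: forced_topv)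
  next
    case False
    show ?thesis
    proof (cases A)
      case (TV X)
      then show ?thesis using step.prems by (auto simp: forced_TV)
    next
      case (Arr B C)
      have "forced \<xi> q B = forced \<xi>' q B" "forced \<xi> q C = forced \<xi>' q C" if "R p q" for q
        using step.prems False that R_W step.IH(2)[of q B] step.IH(2)[of q C] by (auto simp: Arr)
      then show ?thesis using step.prems by (simp add: forced_Arr Arr)
    next
      case (Bul B)
      have "forced \<xi> q B = forced \<xi>' q B" if "S p q" for q
        using step.prems that S_W step.IH(1)[of q B] by (auto simp: Bul)
      then show ?thesis using step.prems by (simp add: forced_Bul Bul)
    next
      case (Mu B)
      have "forced \<xi> p (unfold B) = forced \<xi>' p (unfold B)"
        using step.prems False ftv_unfold[of B] R_refl step.IH(2)[of p "unfold B"]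
          rank_unfold[of B] wf_unfold[of B]
        unfolding Mu by blast
      then show ?thesis using step.prems by (simp add: forced_Mu Mu)
    qed
  qed
qed

text \<open>The semantic meaning of properness: a proper variable matters only at strict successors.
  The last premise ranges over all \<open>R\<close>-successors because implications move there;
  behind a bullet the premise on \<open>S\<close> suffices.\<close>

lemma forced_subst_cong:
  assumes "wf C" "wf u" "wf v" "p \<in> W"
    and "\<And>q. S p q \<Longrightarrow> forced \<xi> q u \<longleftrightarrow> forced \<xi> q v"
    and "\<And>q. R p q \<Longrightarrow> proper k C \<or> (forced \<xi> q u \<longleftrightarrow> forced \<xi> q v)"
  shows "forced \<xi> p (subst C k u) \<longleftrightarrow> forced \<xi> p (subst C k v)"
  using assms
proof (induction p C rule: forced_induct)
  case (step p C)
  show ?case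
  proof (cases "topv C")
    case True
    then show ?thesis using step.prems by (simp add: forced_topv topv_subst wf_subst)
  next
    case False
    show ?thesis
    proof (cases C)
      case (TV X)
      then show ?thesis using step.prems R_refl by auto
    next
      case (Arr A B)
      have "forced \<xi> q (subst A k u) = forced \<xi> q (subst A k v) \<and>
            forced \<xi> q (subst B k u) = forced \<xi> q (subst B k v)" if q: "R p q" for q
      proof -
        have r: "rank A < rank C" "rank B < rank C" using False by (auto simp: Arr)
        have S: "forced \<xi> r u = forced \<xi> r v" if "S q r" for r
          using that q R_S step.prems(5) by blast
        have "proper k A \<or> forced \<xi> r u = forced \<xi> r v"
          "proper k B \<or> forced \<xi> r u = forced \<xi> r v" if "R q r" for r
          using step.prems(6)[of r] False R_trans[OF q that] by (auto simp: Arr)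
        then show ?thesis
          using step.IH(2)[OF q r(1)] step.IH(2)[OF q r(2)] step.prems(1-3) S R_W(2)[OF q]
          by (auto simp: Arr)
      qed
      then show ?thesis using step.prems by (simp add: forced_Arr Arr wf_subst)
    next
      case (Bul B)
      have "forced \<xi> q (subst B k u) = forced \<xi> q (subst B k v)" if q: "S p q" for q
        using step.IH(1)[OF q, of B] step.prems(1-3) S_W(2)[OF q]
          step.prems(5) S_trans[OF q] S_R_S[OF q] by (auto simp: Bul)
      then show ?thesis using step.prems by (simp add: forced_Bul Bul wf_subst)
    next
      case (Mu B)
      have r: "rank (unfold B) < rank C" using False step.prems(1) rank_unfold[of B] unfolding Mu by blast
      have "proper k (unfold B) \<or> forced \<xi> q u = forced \<xi> q v" if "R p q" for q
        using step.prems(6)[OF that] False proper_unfold[of k B] by (auto simp: Mu)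
      then have "forced \<xi> p (subst (unfold B) k u) = forced \<xi> p (subst (unfold B) k v)"
        using step.IH(2)[OF R_refl[OF step.prems(4)] r] step.prems wf_unfold[of B]
        by (simp add: Mu)
      moreover have "wf (Mu (subst B (Suc k) (lift 0 w)))" if "wf w" for w
        using wf_subst[of "Mu B" w k] step.prems(1) that by (simp add: Mu)
      ultimately show ?thesis using step.prems by (simp add: forced_Mu Mu unfold_subst)
    qed
  qed
qed

end

subsection \<open>Soundness of the logic and of subtyping\<close>

lemma la_wf: "la G A \<Longrightarrow> wfset G \<and> wf A"
  by (induction rule: la.induct) (auto simp: wfset_def wf_unfold)

lemma sim_wf: "sim A B \<Longrightarrow> wf A \<and> wf B"
  by (induction rule: sim.induct) (auto simp: wf_unfold wf_Mu_iff)

lemma sub_wf: "sub g A B \<Longrightarrow> wf A \<and> wf B"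
  by (induction rule: sub.induct) (auto simp: wf_Mu_iff dest: sim_wf)

context frame
begin

lemma la_sound:
  assumes "la G A" and \<xi>: "hereditary R \<xi>" and "p \<in> W" "\<And>B. B \<in> G \<Longrightarrow> forced \<xi> p B"
  shows "forced \<xi> p A"
  using assms(1,3,4)
proof (induction arbitrary: p rule: la.induct)
  case (la_assump G A)
  then show ?case by blast
next
  case (la_nec G1 A G2)
  have "wf A" "\<And>B. B \<in> G1 \<Longrightarrow> wf B" using la_wf[OF la_nec.hyps(1)] by (auto simp: wfset_def)
  moreover have "forced \<xi> q A" if q: "S p q" for q
  proof (rule la_nec.IH)
    show "q \<in> W" using q S_W by blast
    show "forced \<xi> q B" if "B \<in> G1" for B
      using la_nec.prems(2)[of "Bul B"] la_nec.prems(1) that q calculation(2) by (auto simp: forced_Bul)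
  qed
  ultimately show ?case using la_nec.prems(1) by (simp add: forced_Bul)
next
  case (la_4 G A)
  have "wf A" using la_wf[OF la_4.hyps] by auto
  then show ?case using la_4 S_W S_trans by (simp add: forced_Bul)
next
  case (la_ArrI A G B)
  have wf: "wf A" "wf B" "\<And>C. C \<in> G \<Longrightarrow> wf C" using la_wf[OF la_ArrI.hyps] by (auto simp: wfset_def)
  have "forced \<xi> q B" if "R p q" "forced \<xi> q A" for q
  proof (rule la_ArrI.IH)
    show "q \<in> W" using R_W that by blast
    show "forced \<xi> q C" if "C \<in> insert A G" for C
      using that \<open>forced \<xi> q A\<close> la_ArrI.prems(2)[of C] forced_hereditary[OF \<xi> wf(3) \<open>R p q\<close>] by blast
  qed
  then show ?case using la_ArrI.prems wf by (simp add: forced_Arr)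
next
  case (la_ArrE G1 A B G2)
  have "wf A" "wf B" using la_wf[OF la_ArrE.hyps(1)] by auto
  then show ?case using la_ArrE R_refl by (auto simp: forced_Arr)
next
  case (la_fold G A)
  then show ?case by (simp add: forced_Mu)
next
  case (la_unfold G A)
  then show ?case using la_wf[OF la_unfold.hyps] by (simp add: forced_Mu)
next
  case (la_L G A B)
  have wf: "wf A" "wf B" using la_wf[OF la_L.hyps] by auto
  have p: "forced \<xi> p (Arr (Bul A) (Bul B))" using la_L by blast
  have "forced \<xi> q' B" if q: "S p q" "R q q'" "forced \<xi> q' A" for q q'
  proof -
    \<comment> \<open>The last frame condition gives a world \<open>r\<close> above \<open>p\<close>
      whose strict successors all lie above \<open>q'\<close>. Hence \<open>r\<close> forces
      \<open>Bul A\<close>, and the hypothesis can be applied there.\<close>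
    obtain r where r: "R p r" "S r q'" "\<forall>s. S r s \<longrightarrow> R q' s" using S_R_lift[OF q(1,2)] by blast
    have "forced \<xi> r (Bul A)"
      using r R_W wf forced_hereditary[OF \<xi> wf(1) _ q(3)] by (simp add: forced_Bul)
    then have "forced \<xi> r (Bul B)" using p r(1) la_L.prems wf by (simp add: forced_Arr)
    then show ?thesis using r R_W wf by (simp add: forced_Bul)
  qed
  then show ?case using la_L.prems wf S_W by (simp add: forced_Bul forced_Arr)
next
  case (la_approx G A)
  have "wf A" using la_wf[OF la_approx.hyps] by auto
  moreover from this have "forced \<xi> q A" if "S p q" for q
    using la_approx forced_hereditary[OF \<xi> _ S_R[OF that]] by blast
  ultimately show ?case using la_approx.prems by (simp add: forced_Bul)
qed

lemma sim_sound:
  assumes "sim A B" and \<xi>: "hereditary R \<xi>" and "p \<in> W"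
  shows "forced \<xi> p A \<longleftrightarrow> forced \<xi> p B"
  using assms(1,3)
proof (induction arbitrary: p rule: sim.induct)
  case (sim_Bul A B)
  then show ?case using sim_wf[OF sim_Bul.hyps] S_W by (simp add: forced_Bul)
next
  case (sim_Arr A C B D)
  then show ?case using sim_wf[OF sim_Arr.hyps(1)] sim_wf[OF sim_Arr.hyps(2)] R_W
    by (simp add: forced_Arr)
next
  case (sim_ArrTop A)
  then show ?case by (simp add: forced_topv topv_Top)
next
  case (sim_unfold A)
  then show ?case by (simp add: forced_Mu)
next
  case (sim_fix A C)
  have wf: "wf A" "wf C" "wf (Mu C)" using sim_wf[OF sim_fix.hyps(1)] sim_fix.hyps by (auto simp: wf_Mu_iff)
  \<comment> \<open>Uniqueness of fixed points: if \<open>A\<close> and \<open>Mu C\<close> agree at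
    all strict successors, then substituting either into the proper \<open>C\<close> gives the same
    value at \<open>p\<close>.\<close>
  show ?case
    using wf_converse_S sim_fix.prems
  proof (induction p rule: wf_induct_rule)
    case (less p)
    have "forced \<xi> q A = forced \<xi> q (Mu C)" if "S p q" for q
      using that less.IH S_W by blast
    then have "forced \<xi> p (subst C 0 A) = forced \<xi> p (subst C 0 (Mu C))"
      using sim_fix.hyps wf less.prems by (intro forced_subst_cong) auto
    then show ?case using sim_fix.IH[OF less.prems] wf less.prems by (simp add: forced_Mu unfold_def)
  qed
next
  case (sim_L A B)
  then have wf: "wf A" "wf B" by auto
  have "la {Bul (Arr A B)} (Arr (Bul A) (Bul B))"
  proof -
    have "la {Arr A B} (Arr A B)" "la {A} A"
      using la_assump[of "{}" "Arr A B"] la_assump[of "{}" A] wf by (auto simp: wfset_def)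
    then have "la {Arr A B, A} B" using la_ArrE by fastforce
    from la_nec[OF this, of "{}"] have "la {Bul A, Bul (Arr A B)} (Bul B)"
      by (simp add: wfset_def insert_commute)
    then show ?thesis by (rule la_ArrI)
  qed
  moreover have "la {Arr (Bul A) (Bul B)} (Bul (Arr A B))"
    using la_L[OF la_assump[of "{}" "Arr (Bul A) (Bul B)"]] wf by (auto simp: wfset_def)
  ultimately show ?case using la_sound \<xi> sim_L.prems by blast
qed auto

text \<open>A variable simulates the recursive type at \<open>p\<close> once the two agree at strict
  successors, since it occurs in proper position.\<close>

lemma forced_inst:
  assumes "wf A" "proper 0 A" "p \<in> W" and "\<And>q. S p q \<Longrightarrow> \<xi> X q \<longleftrightarrow> forced \<xi> q (Mu A)"
  shows "forced \<xi> p (inst A X) \<longleftrightarrow> forced \<xi> p (Mu A)"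
proof -
  have "forced \<xi> p (subst A 0 (TV X)) = forced \<xi> p (subst A 0 (Mu A))"
    using assms S_W by (intro forced_subst_cong) (auto simp: wf_Mu_iff forced_TV)
  then show ?thesis using assms by (simp add: inst_def forced_Mu wf_Mu_iff unfold_def)
qed

text \<open>A subtyping assumption is read as inclusion of the values of its two variables at all
  worlds. The valuation stays arbitrary in the induction because the rule for \<open>Mu\<close>
  reinterprets \<open>X\<close> and \<open>Y\<close>.\<close>

lemma sub_sound:
  assumes "sub g A B" and "hereditary R \<xi>" "p \<in> W" "\<And>X Y q. (X, Y) \<in> g \<Longrightarrow> \<xi> X q \<Longrightarrow> \<xi> Y q"
    and "forced \<xi> p A"
  shows "forced \<xi> p B"
  using assms
proof (induction arbitrary: p \<xi> rule: sub.induct)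
  case (sub_ax X Y g)
  then show ?case by (auto simp: forced_TV)
next
  case (sub_top g A)
  then show ?case by (simp add: forced_topv topv_Top)
next
  case (sub_sim g A B)
  then show ?case using sim_sound by blast
next
  case (sub_trans g1 A B g2 C)
  then show ?case by blast
next
  case (sub_Bul g A B)
  have "forced \<xi> q B" if "S p q" for q
    using sub_wf[OF sub_Bul.hyps] sub_Bul.prems that S_W sub_Bul.IH[of \<xi> q] by (simp add: forced_Bul)
  then show ?case using sub_wf[OF sub_Bul.hyps] sub_Bul.prems(2) by (simp add: forced_Bul)
next
  case (sub_Arr g1 A' A g2 B B')
  have "forced \<xi> q B'" if "R p q" "forced \<xi> q A'" for q
  proof -
    have q: "q \<in> W" using R_W that by blast
    have "forced \<xi> q A" using sub_Arr.prems(1,3) q that by (intro sub_Arr.IH(1)) auto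
    then have "forced \<xi> q B"
      using sub_wf[OF sub_Arr.hyps(1)] sub_wf[OF sub_Arr.hyps(2)] sub_Arr.prems(2,4) that
      by (simp add: forced_Arr)
    then show ?thesis using sub_Arr.prems(1,3) q by (intro sub_Arr.IH(2)) auto
  qed
  then show ?case using sub_wf[OF sub_Arr.hyps(1)] sub_wf[OF sub_Arr.hyps(2)] sub_Arr.prems(2)
    by (simp add: forced_Arr)
next
  case (sub_Mu X Y g A B)
  have wf: "wf (Mu A)" "wf (Mu B)" using sub_Mu.hyps by (auto simp: wf_Mu_iff)
  show ?case
    using wf_converse_S sub_Mu.prems(2,4)
  proof (induction p rule: wf_induct_rule)
    case (less p)
    text \<open>Below \<open>p\<close> the two recursive types are already comparable, and only those worlds matter
      because \<open>X\<close> and \<open>Y\<close> occur in proper positions.\<close>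
    define \<xi>' where "\<xi>' = \<xi>(X := \<lambda>q. S p q \<and> forced \<xi> q (Mu A), Y := \<lambda>q. S p q \<and> forced \<xi> q (Mu B))"
    have val: "\<xi>' X q \<longleftrightarrow> S p q \<and> forced \<xi> q (Mu A)" "\<xi>' Y q \<longleftrightarrow> S p q \<and> forced \<xi> q (Mu B)" for q
      using sub_Mu.hyps(3) by (auto simp: \<xi>'_def)
    have eq: "forced \<xi>' q (Mu A) = forced \<xi> q (Mu A)" "forced \<xi>' q (Mu B) = forced \<xi> q (Mu B)"
      if "q \<in> W" for q
      using wf that sub_Mu.hyps(4,5) by (intro forced_cong_valuation; auto simp: \<xi>'_def simp del: ftv.simps)+
    have her: "hereditary R \<xi>'"
      using sub_Mu.prems(1) S_R_S forced_hereditary[OF sub_Mu.prems(1)] wf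
      by (auto simp: hereditary_def \<xi>'_def)
    have "forced \<xi>' p (inst A X) = forced \<xi>' p (Mu A)"
      using sub_Mu.hyps(3,6,8) less.prems(1) S_W by (intro forced_inst) (auto simp: eq val)
    then have "forced \<xi>' p (inst A X)" using less.prems eq by simp
    moreover have "\<xi>' Y' q" if "(X', Y') \<in> insert (X, Y) g" "\<xi>' X' q" for X' Y' q
    proof (cases "(X', Y') = (X, Y)")
      case True
      then show ?thesis using that sub_Mu.hyps(3) less.IH S_W by (auto simp: \<xi>'_def)
    next
      case False
      then have g: "(X', Y') \<in> g" using that by blast
      then have "X' \<in> ftvs g" "Y' \<in> ftvs g" by (force simp: ftvs_def)+
      then have "X' \<notin> {X, Y}" "Y' \<notin> {X, Y}" using sub_Mu.hyps(4,5) by auto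
      then show ?thesis using that(2) sub_Mu.prems(3)[OF g] by (auto simp: \<xi>'_def)
    qed
    ultimately have "forced \<xi>' p (inst B Y)" using sub_Mu.IH[OF her less.prems(1)] by blast
    moreover have "forced \<xi>' p (inst B Y) = forced \<xi>' p (Mu B)"
      using sub_Mu.hyps(3,7,9) less.prems(1) S_W by (intro forced_inst) (auto simp: eq val)
    ultimately show ?case using eq less.prems by simp
  qed
next
  case (sub_approx g A)
  then show ?case using forced_hereditary S_R by (simp add: forced_Bul) blast
qed

end

subsection \<open>Derived rules of the logic\<close>

lemma wfset_simps [simp]:
  "wfset {}" "wfset (insert A G) \<longleftrightarrow> wf A \<and> wfset G" "wfset (G \<union> H) \<longleftrightarrow> wfset G \<and> wfset H"
  by (auto simp: wfset_def)

lemma la_refl: "wf A \<Longrightarrow> la {A} A"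
  using la_assump[of "{}" A] by simp

text \<open>Weakening enters through the side formulas of \<open>la_assump\<close>: derive
  \<open>Arr A A\<close> from \<open>H\<close> and let \<open>la_ArrE\<close> join the two
  contexts.\<close>

lemma la_weaken:
  assumes "la G A" "G \<subseteq> H" "wfset H"
  shows "la H A"
proof -
  have "la H (Arr A A)" using la_assump[of H A] assms la_wf by (blast intro: la_ArrI)
  from la_ArrE[OF this assms(1)] show ?thesis using assms(2) by (simp add: Un_absorb2)
qed

lemma la_mem: "A \<in> G \<Longrightarrow> wfset G \<Longrightarrow> la G A"
  by (rule la_weaken[OF la_refl]) (auto simp: wfset_def)

lemma la_mp: "la G (Arr A B) \<Longrightarrow> la G A \<Longrightarrow> la G B"
  using la_ArrE[of G A B G] by simp

lemma la_cut: "la (insert A G) B \<Longrightarrow> la G A \<Longrightarrow> la G B"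
  by (blast intro: la_mp la_ArrI)

lemma la_trans:
  assumes "la {A} B" "la G A"
  shows "la G B"
  using la_cut[OF la_weaken[OF assms(1)] assms(2)] la_wf[OF assms(2)] by simp

lemma la_Bul_mono: "la {A} B \<Longrightarrow> la {Bul A} (Bul B)"
  using la_nec[of "{A}" B "{}"] by simp

lemma la_Bul_mp: 
  assumes "la G (Bul (Arr A B))" "la G (Bul A)"
  shows "la G (Bul B)"
proof -
  have wf: "wf A" "wf B" "wfset G" using la_wf[OF assms(1)] by auto
  have "la {Arr A B, A} B" using wf by (intro la_mp[of _ A B] la_mem) auto
  from la_nec[OF this, of G] have "la (insert (Bul (Arr A B)) (insert (Bul A) G)) (Bul B)" using wf by simp
  moreover have "la (insert (Bul A) G) (Bul (Arr A B))" using wf by (intro la_weaken[OF assms(1)]) auto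
  ultimately show ?thesis using assms(2) by (blast intro: la_cut)
qed

text \<open>The proof uses Curry's fixed point \<open>C = \<mu>X. \<bullet>X \<rightarrow> A\<close>.\<close>

lemma la_Loeb:
  assumes "la (insert (Bul A) G) A"
  shows "la G A"
proof -
  have wf: "wf A" "wfset G" using la_wf[OF assms] by auto
  define C where "C = Mu (Arr (Bul (TV 0)) (lift 0 A))"
  have un: "unfold (Arr (Bul (TV 0)) (lift 0 A)) = Arr (Bul C) A" by (simp add: unfold_def C_def)
  have wfC: "wf C" using wf by (simp add: C_def wf_Mu_iff wf_lift proper_lift_same)
  let ?G = "insert (Bul C) G"
  have "la {C} (Arr (Bul C) A)"
    using la_unfold[of "{C}" "Arr (Bul (TV 0)) (lift 0 A)"] la_refl[OF wfC] un by (simp add: C_def)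
  then have "la ?G (Bul (Arr (Bul C) A))"
    by (rule la_trans[OF la_Bul_mono]) (use wf wfC in \<open>auto intro: la_mem\<close>)
  moreover have "la ?G (Bul (Bul C))" using wf wfC by (intro la_4 la_mem) auto
  ultimately have "la ?G (Bul A)" by (rule la_Bul_mp)
  moreover have "la (insert (Bul A) ?G) A" using wf wfC by (intro la_weaken[OF assms]) auto
  ultimately have "la ?G A" by (blast intro: la_cut)
  then have *: "la G (Arr (Bul C) A)" by (rule la_ArrI)
  then have "la G C" using un wfC unfolding C_def by (auto intro: la_fold)
  then show ?thesis using * by (blast intro: la_mp la_approx)
qed

section \<open>Implication and unfolding under a block of bullets\<close>

lemma bullets_Bul [simp]: "bullets n (Bul A) = Bul (bullets n A)"
  by (induction n) auto

lemma wf_bullets [simp]: "wf (bullets n A) \<longleftrightarrow> wf A"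
  by (induction n) auto

lemma la_bullets_mono: "la {A} B \<Longrightarrow> la {bullets n A} (bullets n B)"
  by (induction n) (auto intro: la_Bul_mono)

lemma la_bullets_le:
  assumes "m \<le> n" "la G (bullets m A)"
  shows "la G (bullets n A)"
  using assms by (induction n rule: dec_induct) (auto intro: la_approx)

text \<open>Rule (L) extracts one bullet at a time from an implication between bulleted formulas;
  necessitation applies the earlier extractions under the next bullet.\<close>

lemma la_bullets_ArrI: "la (insert (bullets n A) G) (bullets n B) \<Longrightarrow> la G (bullets n (Arr A B))"
proof -
  have distr: "la {Arr (bullets n A) (bullets n B)} (bullets n (Arr A B))" if "wf A" "wf B" for n
  proof (induction n)
    case 0
    then show ?case using that by (simp add: la_refl)
  next
    case (Suc n)
    have "la {Arr (bullets (Suc n) A) (bullets (Suc n) B)} (Bul (Arr (bullets n A) (bullets n B)))"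
      using that by (auto intro!: la_L la_refl)
    then show ?case using la_trans[OF la_Bul_mono[OF Suc.IH]] by simp
  qed
  assume *: "la (insert (bullets n A) G) (bullets n B)"
  then have "wf A" "wf B" using la_wf[OF *] by auto
  from la_trans[OF distr[OF this] la_ArrI[OF *]] show ?thesis .
qed

lemma la_bullets_mp: "la G (bullets n (Arr A B)) \<Longrightarrow> la G (bullets n A) \<Longrightarrow> la G (bullets n B)"
proof (induction n arbitrary: A B)
  case 0
  then show ?case using la_mp[of G A B] by simp
next
  case (Suc n)
  have wf: "wf A" "wf B" using la_wf[OF Suc.prems(1)] by auto
  have "la {Bul (Arr A B), Bul A} (Bul B)"
    using wf by (intro la_Bul_mp[of _ A B] la_mem) auto
  then have "la {Bul (Arr A B)} (Arr (Bul A) (Bul B))"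
    by (intro la_ArrI) (simp add: insert_commute)
  from la_trans[OF la_bullets_mono[OF this, of n]] Suc.prems(1)
  have "la G (bullets n (Arr (Bul A) (Bul B)))" by simp
  from Suc.IH[OF this] Suc.prems(2) show ?case by simp
qed

lemma la_fold1: "wf (Mu A) \<Longrightarrow> la {unfold A} (Mu A)"
  by (intro la_fold la_refl wf_unfold)

lemma la_unfold1: "wf (Mu A) \<Longrightarrow> la {Mu A} (unfold A)"
  by (intro la_unfold la_refl)

text \<open>Follow the tail of \<open>a\<close>: antecedents are introduced and ignored, bullets are
  added by necessitation, and recursive types are refolded. What remains at the end is
  \<open>u\<close>.\<close>

lemma la_tail_subst:
  assumes "tail_var k a" "wf a" "wf u"
  shows "la {bullets (tail_bul a) u} (subst a k u)"
  using assms
proof (induction a rule: measure_induct_rule[of tail_size])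
  case (less a)
  show ?case
  proof (cases a)
    case (TV i)
    then show ?thesis using less.prems by (simp add: la_refl)
  next
    case (Arr b c)
    then have "la {bullets (tail_bul c) u} (subst c k u)" using less by simp
    then show ?thesis using less.prems by (simp add: Arr) (rule la_ArrI, erule la_weaken, auto simp: wf_subst)
  next
    case (Bul b)
    then show ?thesis using less by (auto intro: la_Bul_mono)
  next
    case (Mu b)
    have nt: "\<not> tail_var 0 b" using less.prems tail_var_unique[of "Suc k" b 0] by (auto simp: Mu)
    have "tail_var k (unfold b)"
      using tail_var_subst[of 0 k b "Mu b"] less.prems by (simp add: unfold_def Mu)
    then have "la {bullets (tail_bul b) u} (subst (unfold b) k u)"
      using less.IH[of "unfold b"] tail_size_unfold[OF nt] less.prems wf_unfold[of b] by (simp add: Mu)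
    moreover have "wf (Mu (subst b (Suc k) (lift 0 u)))"
      using wf_subst[of "Mu b" u k] less.prems by (simp add: Mu)
    ultimately show ?thesis by (auto simp: Mu unfold_subst intro: la_fold)
  qed
qed

text \<open>The interesting case is a tail that returns to the outermost binder. Since a bullet
  guards it, Loeb's rule lets the type be assumed one step later.\<close>

lemma la_topv:
  assumes "topv A" "wf A"
  shows "la {} A"
  using assms
proof (induction A rule: measure_induct_rule[of tail_size])
  case (less A)
  show ?case
  proof (cases A)
    case (TV i)
    then show ?thesis using less.prems by simp
  next
    case (Arr b c)
    then have "la {} c" using less by simp
    then show ?thesis using less.prems by (simp add: Arr) (rule la_ArrI, erule la_weaken, auto)
  next
    case (Bul b)
    then show ?thesis using less by (auto intro: la_approx)
  next
    case (Mu b)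
    have top: "topv (Mu b)" and wf: "wf (Mu b)" "wf b" using less.prems by (auto simp: Mu wf_Mu_iff)
    show ?thesis
    proof (cases "tail_var 0 b")
      case False
      then have "la {} (unfold b)"
        using less.IH[of "unfold b"] tail_size_unfold topv_unfold[OF top] wf_unfold[OF wf(1)]
        by (simp add: Mu)
      then show ?thesis using wf by (auto simp: Mu intro: la_fold)
    next
      case True
      \<comment> \<open>The tail carries at least one bullet, so the Loeb hypothesis can be raised
        to the number of bullets under which \<open>la_tail_subst\<close> expects
        \<open>Mu b\<close>.\<close>
      have "la {Bul (Mu b)} (bullets (tail_bul b) (Mu b))"
        using topv_tail_var_0[OF top True] wf la_bullets_le[of 1 "tail_bul b" "{Bul (Mu b)}" "Mu b"] la_refl[of "Bul (Mu b)"]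
        by simp
      then have "la {Bul (Mu b)} (unfold b)"
        using la_tail_subst[OF True wf(2,1)] la_trans by (auto simp: unfold_def)
      then show ?thesis using wf unfolding Mu by (auto intro: la_Loeb la_fold)
    qed
  qed
qed

subsection \<open>Closure under unfolding\<close>

fun parts :: "ty \<Rightarrow> ty set" where
  "parts (TV i) = {}"
| "parts (Arr a b) = {a, b}"
| "parts (Bul a) = {a}"
| "parts (Mu a) = {unfold a}"

definition unfold_closed :: "ty set \<Rightarrow> bool" where
  "unfold_closed T \<longleftrightarrow> (\<forall>A\<in>T. parts A \<subseteq> T)"

lemma unfold_closedD:
  assumes "unfold_closed T"
  shows "Arr a b \<in> T \<Longrightarrow> a \<in> T" "Arr a b \<in> T \<Longrightarrow> b \<in> T" "Bul a \<in> T \<Longrightarrow> a \<in> T"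
    "Mu a \<in> T \<Longrightarrow> unfold a \<in> T"
  using assms unfolding unfold_closed_def by fastforce+

text \<open>The extra element \<open>unfold a\<close> arises when \<open>c\<close> is the
  substituted variable itself; otherwise taking parts commutes with substitution.\<close>

lemma parts_subst: "parts (subst c 0 (Mu a)) \<subseteq> insert (unfold a) ((\<lambda>d. subst d 0 (Mu a)) ` parts c)"
proof (cases c)
  case (Mu d)
  then show ?thesis using unfold_subst[of d 0 "Mu a"] by simp
qed auto

lemma finite_unfold_closed_1: "\<exists>T. finite T \<and> unfold_closed T \<and> a \<in> T"
proof (induction a)
  case (TV i)
  show ?case by (rule exI[of _ "{TV i}"]) (simp add: unfold_closed_def)
next
  case (Arr a b)
  then obtain T U where "finite T" "unfold_closed T" "a \<in> T" "finite U" "unfold_closed U" "b \<in> U"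
    by blast
  then show ?case
    by (intro exI[of _ "insert (Arr a b) (T \<union> U)"]) (auto simp: unfold_closed_def)
next
  case (Bul a)
  then obtain T where "finite T" "unfold_closed T" "a \<in> T" by blast
  then show ?case by (intro exI[of _ "insert (Bul a) T"]) (auto simp: unfold_closed_def)
next
  case (Mu a)
  then obtain T where T: "finite T" "unfold_closed T" "a \<in> T" by blast
  \<comment> \<open>The closure of the body with \<open>Mu a\<close> put for its variable. The one
    new part, \<open>unfold a\<close>, is the image of the body \<open>a\<close> itself, so the set
    stays finite.\<close>
  let ?U = "insert (Mu a) ((\<lambda>c. subst c 0 (Mu a)) ` T)"
  have "unfold a \<in> ?U" using T by (simp add: unfold_def)
  moreover have "parts (subst c 0 (Mu a)) \<subseteq> ?U" if "c \<in> T" for c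
  proof -
    have "parts c \<subseteq> T" using that T(2) by (simp add: unfold_closed_def)
    then show ?thesis using parts_subst[of c a] calculation by blast
  qed
  ultimately have "unfold_closed ?U" by (simp add: unfold_closed_def)
  then show ?case using T by (intro exI[of _ ?U]) simp
qed

lemma wf_parts: "wf A \<Longrightarrow> B \<in> parts A \<Longrightarrow> wf B"
  by (cases A) (auto intro: wf_unfold)

lemma finite_unfold_closed:
  assumes "wfset G"
  obtains T where "finite T" "unfold_closed T" "G \<subseteq> T" "\<And>A. A \<in> T \<Longrightarrow> wf A"
proof -
  obtain f where f: "\<And>a. finite (f a) \<and> unfold_closed (f a) \<and> a \<in> f a"
    using finite_unfold_closed_1 by metis
  let ?T = "\<Union>(f ` G) \<inter> {A. wf A}"
  show ?thesis
  proof (rule that[of ?T])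
    show "finite ?T" "G \<subseteq> ?T" using f assms by (auto simp: wfset_def)
    show "unfold_closed ?T" using f wf_parts unfolding unfold_closed_def by blast
  qed simp
qed

subsection \<open>Goal-directed search\<close>

text \<open>A pair \<open>(m, A)\<close> stands for \<open>bullets m A\<close>.  Variables guarded by \<open>K\<close> or more bullets are
  taken for granted; \<open>focus K G l A k X\<close> says that \<open>bullets l A\<close> yields \<open>bullets k (TV X)\<close>.\<close>

inductive search :: "nat \<Rightarrow> (nat \<times> ty) set \<Rightarrow> nat \<Rightarrow> ty \<Rightarrow> bool"
  and focus :: "nat \<Rightarrow> (nat \<times> ty) set \<Rightarrow> nat \<Rightarrow> ty \<Rightarrow> nat \<Rightarrow> nat \<Rightarrow> bool"
  for K where
  search_limit: "K \<le> k \<Longrightarrow> search K G k (TV X)"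
| search_topv: "topv A \<Longrightarrow> search K G k A"
| search_Bul: "search K G (Suc k) A \<Longrightarrow> search K G k (Bul A)"
| search_Mu: "search K G k (unfold A) \<Longrightarrow> search K G k (Mu A)"
| search_Arr: "search K (insert (k, A) G) k B \<Longrightarrow> search K G k (Arr A B)"
| search_focus: "(m, A) \<in> G \<Longrightarrow> m \<le> l \<Longrightarrow> focus K G l A k X \<Longrightarrow> search K G k (TV X)"
| focus_TV: "l \<le> k \<Longrightarrow> focus K G l (TV X) k X"
| focus_Bul: "focus K G (Suc l) A k X \<Longrightarrow> focus K G l (Bul A) k X"
| focus_Mu: "focus K G l (unfold A) k X \<Longrightarrow> focus K G l (Mu A) k X"
| focus_Arr: "search K G l A \<Longrightarrow> focus K G l B k X \<Longrightarrow> focus K G l (Arr A B) k X"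

lemma search_mono: "search K G k A \<Longrightarrow> G \<subseteq> H \<Longrightarrow> search K H k A"
  and focus_mono: "focus K G l A k X \<Longrightarrow> G \<subseteq> H \<Longrightarrow> focus K H l A k X"
proof (induction arbitrary: H and H rule: search_focus.inducts)
  case (search_Arr k A G B)
  then show ?case by (intro search_focus.search_Arr) blast
next
  case (search_focus m A G l k X)
  then show ?case by (blast intro: search_focus.search_focus)
qed (auto intro: search_focus.intros)

lemma focus_le: "focus K G l A k X \<Longrightarrow> l \<le> k"
  by (induction rule: search_focus.inducts(2)[where ?P1.0 = "\<lambda>_ _ _. True"]) auto

lemma focus_level_mono: "focus K G l A k X \<Longrightarrow> k \<le> k' \<Longrightarrow> focus K G l A k' X"
  by (induction rule: search_focus.inducts(2)[where ?P1.0 = "\<lambda>_ _ _. True"])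
     (auto intro: search_focus.intros)

text \<open>For a variable goal the level enters only at the limit test and at the leaf of a focus,
  so it can be raised. This makes the valuation of the search model hereditary.\<close>

lemma search_TV_mono:
  assumes "search K G k (TV X)" "G \<subseteq> H" "k \<le> k'"
  shows "search K H k' (TV X)"
  using search_mono[OF assms(1,2)]
proof cases
  case search_limit
  then show ?thesis using assms by (auto intro: search_focus.search_limit)
next
  case search_topv
  then show ?thesis by simp
next
  case (search_focus m A l)
  then show ?thesis using assms focus_level_mono by (blast intro: search_focus.search_focus)
qed

text \<open>Decomposing the goal along its tail never lowers the level, so the final variable is met
  beyond the limit. Goals that are top-variants succeed at once.\<close>

lemma search_beyond_limit:
  assumes "K \<le> k" "wf A"
  shows "search K G k A"
  using assms
proof (induction A arbitrary: k G rule: measure_induct_rule[of tail_size])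
  case (less A)
  show ?case
  proof (cases "topv A")
    case True
    then show ?thesis by (rule search_topv)
  next
    case False
    show ?thesis
    proof (cases A)
      case (Mu b)
      have "\<not> tail_var 0 b" using False less.prems by (auto simp: Mu not_tail_var_0)
      then show ?thesis
        using less tail_size_unfold(1)[of b] wf_unfold[of b] by (auto simp: Mu intro: search_Mu)
    qed (use less in \<open>auto intro: search_limit search_Arr search_Bul\<close>)
  qed
qed

subsection \<open>The model of unsuccessful searches\<close>

text \<open>The injection \<open>e\<close> places the search states in an arbitrary type of worlds,
  so that validity over that type can be applied to the model.\<close>

locale search_model =
  fixes e :: "nat \<times> (nat \<times> ty) set \<Rightarrow> 'w" and K :: nat
  assumes inj_e: "inj e"
begin

text \<open>The search state \<open>(k, G)\<close> is represented by the world
  \<open>e (Suc k, G)\<close>; hence \<open>k < K\<close> for states while levels of worlds run up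
  to \<open>K\<close>.\<close>

definition "Ws = e ` {(k, G). k \<le> K}"
definition "Ss p q \<longleftrightarrow> (\<exists>k G l H. p = e (k, G) \<and> q = e (l, H) \<and> k < l \<and> l \<le> K \<and> G \<subseteq> H)"
definition "Rs p q \<longleftrightarrow> (\<exists>k G l H. p = e (k, G) \<and> q = e (l, H) \<and> k \<le> l \<and> l \<le> K \<and> G \<subseteq> H)"

text \<open>The worlds of level 0 lie below the search states; they serve the shift rule.\<close>

definition "xs X p \<longleftrightarrow> (\<exists>k G. p = e (Suc k, G) \<and> search K G k (TV X))"

lemma e_eq: "e x = e y \<longleftrightarrow> x = y"
  using inj_e by (auto dest: injD)

lemma e_W: "e (k, G) \<in> Ws \<longleftrightarrow> k \<le> K"
  by (auto simp: Ws_def e_eq)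

lemma e_S: "Ss (e (k, G)) (e (l, H)) \<longleftrightarrow> k < l \<and> l \<le> K \<and> G \<subseteq> H"
  by (auto simp: Ss_def e_eq)

lemma e_R: "Rs (e (k, G)) (e (l, H)) \<longleftrightarrow> k \<le> l \<and> l \<le> K \<and> G \<subseteq> H"
  by (auto simp: Rs_def e_eq)

lemma e_xs: "xs X (e (Suc k, G)) \<longleftrightarrow> search K G k (TV X)"
  by (auto simp: xs_def e_eq)

lemma Ss_cases:
  assumes "Ss (e (k, G)) q"
  obtains l H where "q = e (Suc l, H)" "k \<le> l" "l < K" "G \<subseteq> H"
proof -
  obtain l H where q: "q = e (l, H)" using assms by (auto simp: Ss_def)
  then have "k < l" "l \<le> K" "G \<subseteq> H" using assms by (auto simp: e_S)
  then show ?thesis using q that[of "l - 1" H] by (cases l) auto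
qed

lemma Rs_cases:
  assumes "Rs (e (Suc k, G)) q"
  obtains l H where "q = e (Suc l, H)" "k \<le> l" "l < K" "G \<subseteq> H"
proof -
  obtain l H where q: "q = e (l, H)" using assms by (auto simp: Rs_def)
  then have "Suc k \<le> l" "l \<le> K" "G \<subseteq> H" using assms by (auto simp: e_R)
  then show ?thesis using q that[of "l - 1" H] by (cases l) auto
qed

lemma no_Ss_chain: "\<not> (\<forall>n. Ss (f n) (f (Suc n)))"
proof
  assume chain: "\<forall>n. Ss (f n) (f (Suc n))"
  have "\<exists>k G. f n = e (k, G) \<and> n \<le> k \<and> k \<le> K" for n
  proof (induction n)
    case 0
    obtain k G l H where "f 0 = e (k, G)" "k < l" "l \<le> K" using chain[rule_format, of 0] by (auto simp: Ss_def)
    then show ?case by auto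
  next
    case (Suc n)
    then obtain k G where n: "f n = e (k, G)" "n \<le> k" by blast
    then have "Ss (e (k, G)) (f (Suc n))" using chain by metis
    then show ?case using n by (auto elim!: Ss_cases)
  qed
  from this[of "Suc K"] show False by auto
qed

lemma la_frame: "la_frame Ws Ss Rs"
  unfolding la_frame_def
proof (intro conjI allI impI)
  show "Ws \<noteq> {}" by (auto simp: Ws_def)
  show "\<not> (\<exists>f. \<forall>n. Ss (f n) (f (Suc n)))" using no_Ss_chain by blast
  show "\<forall>p\<in>Ws. Rs p p" by (auto simp: Ws_def e_R)
  show "p \<in> Ws" "q \<in> Ws" if "Ss p q" for p q using that by (auto simp: Ss_def e_W)
  show "p \<in> Ws" "q \<in> Ws" if "Rs p q" for p q using that by (auto simp: Rs_def e_W)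
  show "Rs p r" if "Rs p q" "Rs q r" for p q r using that by (fastforce simp: Rs_def e_eq)
  show "Ss p r" if "Rs p q" "Ss q r" for p q r using that by (fastforce simp: Rs_def Ss_def e_eq)
  show "Rs p q" if "Ss p q" for p q using that by (fastforce simp: Rs_def Ss_def)
  fix p q q' assume "Ss p q" "Rs q q'"
  then obtain k G l H l' H' where *: "p = e (k, G)" "q' = e (l', H')" "k < l" "l \<le> l'" "l' \<le> K"
    "G \<subseteq> H" "H \<subseteq> H'"
    by (auto simp: Ss_def Rs_def e_eq)
  \<comment> \<open>The witness keeps the hypotheses of \<open>q'\<close> one level lower, so its
    strict successors have at least the level of \<open>q'\<close>. Here \<open>l'\<close> is
    positive, so the subtraction is genuine.\<close>
  show "\<exists>r. Rs p r \<and> Ss r q' \<and> (\<forall>s. Ss r s \<longrightarrow> Rs q' s)"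
  proof (intro exI[of _ "e (l' - 1, H')"] conjI allI impI)
    show "Rs p (e (l' - 1, H'))" "Ss (e (l' - 1, H')) q'" using * by (auto simp: e_R e_S)
    show "Rs q' s" if "Ss (e (l' - 1, H')) s" for s
      using that * by (auto elim!: Ss_cases simp: e_R)
  qed
qed

sublocale frame Ws Ss Rs
  by unfold_locales (rule la_frame)

lemma hereditary_xs: "hereditary Rs xs"
  unfolding hereditary_def
proof (intro allI impI)
  fix X p q assume "Rs p q" "xs X p"
  then obtain k G where "p = e (Suc k, G)" "search K G k (TV X)" by (auto simp: xs_def)
  then show "xs X q" using \<open>Rs p q\<close> by (auto elim!: Rs_cases simp: e_xs intro: search_TV_mono)
qed

text \<open>Membership in \<open>G\<close> is too narrow for the induction, since focusing reaches
  components of a hypothesis that need not be in \<open>G\<close>. \<open>usable\<close> keeps the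
  effect of \<open>search_focus\<close>, stably under growth of hypotheses and level.\<close>

definition usable :: "(nat \<times> ty) set \<Rightarrow> nat \<Rightarrow> ty \<Rightarrow> bool" where
  "usable G k A \<longleftrightarrow>
    (\<forall>H l j X. G \<subseteq> H \<longrightarrow> k \<le> l \<longrightarrow> focus K H l A j X \<longrightarrow> search K H j (TV X))"

lemma usable_mono: "usable G k A \<Longrightarrow> G \<subseteq> H \<Longrightarrow> k \<le> l \<Longrightarrow> usable H l A"
  unfolding usable_def by (meson order_trans)

lemma usable_mem: "(k, A) \<in> G \<Longrightarrow> usable G k A"
  unfolding usable_def by (blast intro: search_focus)

text \<open>The truth lemma of the model. The halves depend on each other: a usable implication
  needs the second half for its antecedent, and an implication as goal needs the first half for the
  new hypothesis.\<close>

lemma search_truth_aux: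
  assumes "wf A" "k < K" "p = e (Suc k, G)"
  shows "(usable G k A \<longrightarrow> forced xs p A) \<and> (forced xs p A \<longrightarrow> search K G k A)"
  using assms
proof (induction p A arbitrary: k G rule: forced_induct)
  case (step p A)
  have p: "p \<in> Ws" using step.prems by (simp add: e_W)
  show ?case
  proof (cases "topv A")
    case True
    then show ?thesis using step.prems p by (auto intro: forced_topv search_topv)
  next
    case False
    show ?thesis
    proof (cases A)
      case (TV X)
      have "usable G k A \<Longrightarrow> search K G k (TV X)"
        unfolding usable_def TV by (blast intro: focus_TV)
      then show ?thesis using step.prems p by (auto simp: TV forced_TV e_xs)
    next
      case (Arr B C)
      have wf: "wf B" "wf C" using step.prems by (auto simp: Arr)
      have rank: "rank B < rank A" "rank C < rank A" using False by (auto simp: Arr)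
      show ?thesis
      proof (intro conjI impI)
        assume us: "usable G k A"
        have "forced xs q C" if q: "Rs p q" "forced xs q B" for q
        proof -
          from q(1) obtain l H where lH: "q = e (Suc l, H)" "k \<le> l" "l < K" "G \<subseteq> H"
            unfolding step.prems(3) by (rule Rs_cases)
          have "usable H l C"
            unfolding usable_def
          proof (intro allI impI)
            fix H' l' j X assume H': "H \<subseteq> H'" "l \<le> l'" and foc: "focus K H' l' C j X"
            \<comment> \<open>From level \<open>K\<close> on no world represents the state, but
              there every search succeeds.\<close>
            have "search K H' l' B"
            proof (cases "l' < K")
              case True
              have R: "Rs q (e (Suc l', H'))" using lH H' True by (simp add: e_R)
              have "forced xs (e (Suc l', H')) B"
                using forced_hereditary[OF hereditary_xs wf(1) R q(2)] .
              then show ?thesis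
                using step.IH(2)[OF R_trans[OF q(1) R] rank(1) wf(1) True refl] by blast
            next
              case False
              then show ?thesis using wf by (simp add: search_beyond_limit)
            qed
            then have "focus K H' l' A j X" unfolding Arr using foc by (rule focus_Arr)
            then show "search K H' j (TV X)"
              using us lH H' unfolding usable_def by (meson order_trans)
          qed
          then show ?thesis using step.IH(2)[OF q(1) rank(2) wf(2) lH(3,1)] by blast
        qed
        then show "forced xs p A" using wf p by (simp add: Arr forced_Arr)
      next
        assume f: "forced xs p A"
        let ?G = "insert (k, B) G" and ?q = "e (Suc k, insert (k, B) G)"
        have R: "Rs p ?q" using step.prems by (auto simp: e_R)
        have "forced xs ?q B"
          using step.IH(2)[OF R rank(1) wf(1) step.prems(2) refl] by (simp add: usable_mem)
        then have "forced xs ?q C" using f R wf p by (simp add: Arr forced_Arr)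
        then have "search K ?G k C"
          using step.IH(2)[OF R rank(2) wf(2) step.prems(2) refl] by simp
        then show "search K G k A" unfolding Arr by (rule search_Arr)
      qed
    next
      case (Bul B)
      have wf: "wf B" using step.prems by (simp add: Bul)
      show ?thesis
      proof (intro conjI impI)
        assume us: "usable G k A"
        have "usable G (Suc k) B"
          unfolding usable_def
        proof (intro allI impI)
          fix H l j X assume H: "G \<subseteq> H" "Suc k \<le> l" "focus K H l B j X"
          \<comment> \<open>\<open>l\<close> is positive, so focusing on \<open>Bul B\<close> at
            \<open>l - 1\<close> continues with \<open>B\<close> at exactly
            \<open>l\<close>.\<close>
          then have "focus K H (l - 1) A j X" unfolding Bul by (intro focus_Bul) simp
          then show "search K H j (TV X)" using us H unfolding usable_def
            by (metis Suc_le_D Suc_le_mono diff_Suc_1)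
        qed
        then have "forced xs q B" if q: "Ss p q" for q
          using Ss_cases[OF q[unfolded step.prems(3)]] step.IH(1)[OF q wf] usable_mono Suc_le_eq
          by (metis Suc_le_mono)
        then show "forced xs p A" using wf p by (simp add: Bul forced_Bul)
      next
        assume f: "forced xs p A"
        have "search K G (Suc k) B"
        proof (cases "Suc k < K")
          case True
          then have S: "Ss p (e (Suc (Suc k), G))" using step.prems by (simp add: e_S)
          then have "forced xs (e (Suc (Suc k), G)) B" using f wf p by (simp add: Bul forced_Bul)
          then show ?thesis using step.IH(1)[OF S wf True refl] by blast
        next
          case False
          then show ?thesis using wf by (simp add: search_beyond_limit)
        qed
        then show "search K G k A" unfolding Bul by (rule search_Bul)
      qed
    next
      case (Mu B)
      have wf: "wf (Mu B)" using step.prems by (simp add: Mu)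
      have rank: "rank (unfold B) < rank A" using wf False rank_unfold unfolding Mu by blast
      have "usable G k A \<Longrightarrow> usable G k (unfold B)"
        unfolding usable_def Mu by (blast intro: focus_Mu)
      then show ?thesis
        using step.IH(2)[OF R_refl[OF p] rank wf_unfold[OF wf] step.prems(2,3)] wf p
        by (auto simp: Mu forced_Mu intro: search_Mu)
    qed
  qed
qed

lemma usable_forced: "wf A \<Longrightarrow> k < K \<Longrightarrow> usable G k A \<Longrightarrow> forced xs (e (Suc k, G)) A"
  and forced_search: "wf A \<Longrightarrow> k < K \<Longrightarrow> forced xs (e (Suc k, G)) A \<Longrightarrow> search K G k A"
  using search_truth_aux by blast+

end

subsection \<open>Successful searches yield derivations\<close>

abbreviation pair_formulas :: "(nat \<times> ty) set \<Rightarrow> ty set" where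
  "pair_formulas G \<equiv> (\<lambda>(m, A). bullets m A) ` G"

locale search_closure =
  fixes T :: "ty set" and c K :: nat
  assumes finite_T: "finite T" and closed_T: "unfold_closed T" and wf_T: "A \<in> T \<Longrightarrow> wf A"
    and tail_bul_T: "A \<in> T \<Longrightarrow> tail_bul A \<le> c"
begin

definition "V = {X. TV X \<in> T}"

text \<open>\<open>D\<close> collects the variables that have already been a goal, hence by Loeb's rule may be
  assumed one step later.  A goal outside \<open>D\<close> raises the bound \<open>b\<close> by at most \<open>c + 1\<close>.\<close>

definition bounded_state :: "(nat \<times> ty) set \<Rightarrow> nat set \<Rightarrow> nat \<Rightarrow> bool" where
  "bounded_state G D b \<longleftrightarrow> finite G \<and> snd ` G \<subseteq> T \<and> (\<forall>X\<in>D. \<exists>j\<le>b. (j, TV X) \<in> G) \<and>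
     b + (c + 1) * card (V - D) < K"

lemma finite_V: "finite V"
  using finite_imageI[OF finite_T, of "\<lambda>A. case A of TV X \<Rightarrow> X | _ \<Rightarrow> 0"]
  by (rule finite_subset[rotated]) (force simp: V_def)

lemma wfset_pair_formulas: "bounded_state G D b \<Longrightarrow> wfset (pair_formulas G)"
  using wf_T by (fastforce simp: bounded_state_def wfset_def)

lemma bounded_state_insert:
  "bounded_state G D b \<Longrightarrow> A \<in> T \<Longrightarrow> bounded_state (insert (k, A) G) D b"
  by (auto simp: bounded_state_def)

lemma la_bullets_topv: "topv A \<Longrightarrow> A \<in> T \<Longrightarrow> bounded_state G D b \<Longrightarrow> la (pair_formulas G) (bullets k A)"
  using la_bullets_le[of 0 k "{}" A] la_topv[of A] wf_T wfset_pair_formulas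
  by (auto intro: la_weaken)

text \<open>\<open>G'\<close> exceeds \<open>G\<close> by Loeb hypotheses. A variable goal at level
  \<open>k\<close> raises the bound above \<open>k\<close>; antecedents met in the focus have level
  at most \<open>k\<close>, so their final variables stay within \<open>b + c\<close>.\<close>

lemma search_sound_aux:
  "search K G k A \<Longrightarrow> G \<subseteq> G' \<Longrightarrow> bounded_state G' D b \<Longrightarrow> A \<in> T \<Longrightarrow> topv A \<or> k + tail_bul A \<le> b + c \<Longrightarrow>
    la (pair_formulas G') (bullets k A)"
  and focus_sound_aux:
  "focus K G l A k X \<Longrightarrow> G \<subseteq> G' \<Longrightarrow> bounded_state G' D b \<Longrightarrow> A \<in> T \<Longrightarrow> k \<le> b \<Longrightarrow>
    la (insert (bullets l A) (pair_formulas G')) (bullets k (TV X))"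
proof (induction arbitrary: G' D b and G' D b rule: search_focus.inducts)
  case (search_limit k G X)
  then have V: "X \<in> V" and k: "k \<le> b + c" by (auto simp: V_def)
  \<comment> \<open>A goal outside \<open>D\<close> leaves a budget of at least \<open>c + 1\<close>
    above \<open>b\<close>, so a level of at most \<open>b + c\<close> cannot reach
    \<open>K\<close>. For a goal in \<open>D\<close> the stored hypothesis suffices, its level being
    below \<open>K\<close>.\<close>
  have "X \<in> D"
  proof (rule ccontr)
    assume "X \<notin> D"
    then have "card (V - D) \<noteq> 0" using V finite_V by auto
    then have "(c + 1) * 1 \<le> (c + 1) * card (V - D)" by (intro mult_le_mono) auto
    then show False using search_limit k by (auto simp: bounded_state_def)
  qed
  then obtain j where j: "j \<le> b" "(j, TV X) \<in> G'" using search_limit by (auto simp: bounded_state_def)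
  then have "bullets j (TV X) \<in> pair_formulas G'" by force
  then have "la (pair_formulas G') (bullets j (TV X))"
    using wfset_pair_formulas[OF search_limit.prems(2)] by (rule la_mem)
  moreover have "j \<le> k" using j search_limit by (auto simp: bounded_state_def)
  ultimately show ?case by (rule la_bullets_le[rotated])
next
  case (search_topv A G k)
  then show ?case by (intro la_bullets_topv)
next
  case (search_Bul G k A)
  then have "la (pair_formulas G') (bullets (Suc k) A)"
    using unfold_closedD(3)[OF closed_T] by (intro search_Bul.IH(2)[of _ D b]) auto
  then show ?case by simp
next
  case (search_Mu G k A)
  have wf: "wf (Mu A)" using search_Mu wf_T by blast
  show ?case
  proof (cases "topv (Mu A)")
    case True
    then show ?thesis using search_Mu by (intro la_bullets_topv)
  next
    case False
    then have "la (pair_formulas G') (bullets k (unfold A))"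
      using search_Mu.prems unfold_closedD(4)[OF closed_T] tail_size_unfold(2)[OF not_tail_var_0[OF wf False]]
      by (intro search_Mu.IH(2)[of _ D b]) auto
    then show ?thesis by (rule la_trans[OF la_bullets_mono[OF la_fold1[OF wf]]])
  qed
next
  case (search_Arr k A G B)
  have T: "A \<in> T" "B \<in> T" using search_Arr.prems unfold_closedD(1,2)[OF closed_T] by blast+
  have "la (pair_formulas (insert (k, A) G')) (bullets k B)"
    using search_Arr.prems T by (intro search_Arr.IH(2)[of _ D b] bounded_state_insert) auto
  then show ?case by (intro la_bullets_ArrI) simp
next
  case (search_focus m A G l k X)
  have wfs: "wfset (pair_formulas G')" by (rule wfset_pair_formulas[OF search_focus.prems(2)])
  have mem: "la (pair_formulas G') (bullets j B)" if "(i, B) \<in> G'" "i \<le> j" for i j B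
  proof (rule la_bullets_le[OF that(2) la_mem[OF _ wfs]])
    show "bullets i B \<in> pair_formulas G'" using that by force
  qed
  show ?case
  proof (cases "\<exists>j\<le>k. (j, TV X) \<in> G'")
    case True
    then show ?thesis using mem by blast
  next
    case False
    let ?G = "insert (Suc k, TV X) G'" and ?D = "insert X D" and ?b = "max b (Suc k)"
    \<comment> \<open>If \<open>X\<close> is in \<open>D\<close>, its stored level exceeds
      \<open>k\<close>, so the bound does not grow. Otherwise it grows by at most
      \<open>c + 1\<close>, paid for by the new element of \<open>D\<close>.\<close>
    have "?b + (c + 1) * card (V - ?D) < K"
    proof (cases "X \<in> D")
      case True
      then obtain j where "j \<le> b" "(j, TV X) \<in> G'" using search_focus.prems by (auto simp: bounded_state_def)
      then have "Suc k \<le> b" using False by (meson not_less_eq_eq order_trans)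
      then show ?thesis using True search_focus.prems by (simp add: bounded_state_def insert_absorb max_absorb1)
    next
      case X: False
      have "X \<in> V - D" using X search_focus.prems by (auto simp: V_def)
      then have "card (V - D) = Suc (card (V - ?D))"
        using finite_V by (metis Diff_insert card_Suc_Diff1 finite_Diff)
      then show ?thesis using search_focus.prems by (auto simp: bounded_state_def)
    qed
    moreover have "\<exists>j\<le>?b. (j, TV Y) \<in> ?G" if "Y \<in> ?D" for Y
      using that search_focus.prems(2) unfolding bounded_state_def
      by (metis insert_iff max.cobounded2 max.coboundedI1)
    ultimately have st: "bounded_state ?G ?D ?b"
      using search_focus.prems(2,3) unfolding bounded_state_def by simp
    have "(m, A) \<in> G'" using search_focus.hyps search_focus.prems(1) by blast
    then have "A \<in> T" using search_focus.prems(2) by (auto simp: bounded_state_def)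
    then have "la (insert (bullets l A) (pair_formulas ?G)) (bullets k (TV X))"
      using search_focus.prems(1) by (intro search_focus.IH(2)[OF _ st]) auto
    moreover have "la (pair_formulas ?G) (bullets l A)"
    proof (rule la_weaken[OF mem])
      show "(m, A) \<in> G'" "m \<le> l" by fact+
      show "wfset (pair_formulas ?G)" by (rule wfset_pair_formulas[OF st])
    qed auto
    ultimately have "la (pair_formulas ?G) (bullets k (TV X))" by (rule la_cut)
    then show ?thesis using la_Loeb[of "bullets k (TV X)"] by simp
  qed
next
  case (focus_TV l k G X)
  then show ?case
    using wfset_pair_formulas by (intro la_bullets_le[OF focus_TV.hyps] la_mem) auto
next
  case (focus_Bul G l A k X)
  then have "la (insert (bullets (Suc l) A) (pair_formulas G')) (bullets k (TV X))"
    using unfold_closedD(3)[OF closed_T] by (intro focus_Bul.IH(2)[of _ D b]) auto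
  then show ?case by simp
next
  case (focus_Mu G l A k X)
  have wf: "wf (Mu A)" using focus_Mu wf_T by blast
  let ?H = "insert (bullets l (Mu A)) (pair_formulas G')"
  have wfs: "wfset ?H" using wf wfset_pair_formulas[OF focus_Mu.prems(2)] by simp
  have "la (insert (bullets l (unfold A)) (pair_formulas G')) (bullets k (TV X))"
    using focus_Mu unfold_closedD(4)[OF closed_T] by (intro focus_Mu.IH(2)[of _ D b]) auto
  then have "la (insert (bullets l (unfold A)) ?H) (bullets k (TV X))"
    by (rule la_weaken) (use wfs wf_unfold[OF wf] in auto)
  moreover have "la ?H (bullets l (unfold A))"
    by (rule la_trans[OF la_bullets_mono[OF la_unfold1[OF wf]] la_mem[OF _ wfs]]) simp
  ultimately show ?case by (rule la_cut)
next
  case (focus_Arr G l A B k X)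
  have T: "A \<in> T" "B \<in> T" using focus_Arr.prems unfold_closedD(1,2)[OF closed_T] by blast+
  let ?H = "insert (bullets l (Arr A B)) (pair_formulas G')"
  have wfs: "wfset ?H" using wf_T[OF focus_Arr.prems(3)] wfset_pair_formulas[OF focus_Arr.prems(2)] by simp
  have "l + tail_bul A \<le> b + c"
    using focus_le[OF focus_Arr.IH(3)] focus_Arr.prems tail_bul_T[OF T(1)] by simp
  then have "la (pair_formulas G') (bullets l A)"
    using focus_Arr.prems T by (intro focus_Arr.IH(2)[of _ D b]) auto
  then have "la ?H (bullets l A)" by (rule la_weaken) (use wfs in auto)
  moreover have "la ?H (bullets l (Arr A B))" using wfs by (intro la_mem) auto
  ultimately have "la ?H (bullets l B)" by (blast intro: la_bullets_mp)
  moreover have "la (insert (bullets l B) (pair_formulas G')) (bullets k (TV X))"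
    using focus_Arr.prems T by (intro focus_Arr.IH(4)[of _ D b]) auto
  then have "la (insert (bullets l B) ?H) (bullets k (TV X))"
    by (rule la_weaken) (use wfs in auto)
  ultimately show ?case by (blast intro: la_cut)
qed

end

lemma search_sound:
  assumes "wfset G" "wf B"
  shows "\<exists>K>0. search K (Pair 0 ` G) 0 B \<longrightarrow> la G B"
proof -
  obtain T where T: "finite T" "unfold_closed T" "insert B G \<subseteq> T" "\<And>A. A \<in> T \<Longrightarrow> wf A"
    using finite_unfold_closed[of "insert B G"] assms by auto
  define c where "c = Max (tail_bul ` T)"
  \<comment> \<open>One more than the budget needed from bound 0 with no variable yet
    visited.\<close>
  define K where "K = Suc ((c + 1) * card {X. TV X \<in> T})"
  interpret search_closure T c K
    using T by unfold_locales (auto simp: c_def)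
  have "bounded_state (Pair 0 ` G) {} 0"
    using assms T by (simp add: bounded_state_def V_def wfset_def image_image) (simp add: K_def)
  moreover have "pair_formulas (Pair 0 ` G) = G" by (force simp: image_image)
  ultimately have "la G B" if "search K (Pair 0 ` G) 0 B"
    using search_sound_aux[OF that subset_refl, of "{}" 0] T tail_bul_T[of B] by auto
  then show ?thesis by (intro exI[of _ K]) (simp add: K_def)
qed

subsection \<open>Completeness and the shift rule\<close>

text \<open>The limit \<open>K\<close> is chosen for this sequent alone. At the state with level 0
  and hypotheses \<open>G\<close> all of \<open>G\<close> is forced, hence \<open>B\<close>, hence
  the search for \<open>B\<close> succeeds.\<close>

lemma completeness:
  fixes e :: "nat \<times> (nat \<times> ty) set \<Rightarrow> 'w"
  assumes "inj e" "wfset G" "wf B"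
    and valid: "\<And>(W :: 'w set) S R \<xi> p. la_frame W S R \<Longrightarrow> hereditary R \<xi> \<Longrightarrow> p \<in> W \<Longrightarrow>
      (\<forall>A\<in>G. forces W S R \<xi> p A) \<Longrightarrow> forces W S R \<xi> p B"
  shows "la G B"
proof -
  obtain K where K: "0 < K" "search K (Pair 0 ` G) 0 B \<longrightarrow> la G B"
    using search_sound[OF assms(2,3)] by blast
  interpret search_model e K by unfold_locales (rule assms(1))
  have "forced xs (e (Suc 0, Pair 0 ` G)) A" if "A \<in> G" for A
    using that K(1) assms(2) by (auto simp: wfset_def intro!: usable_forced usable_mem)
  then have "forced xs (e (Suc 0, Pair 0 ` G)) B"
    using K(1) by (intro valid[OF la_frame hereditary_xs]) (auto simp: e_W)
  then show ?thesis using K assms(3) by (blast intro: forced_search)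
qed

text \<open>At the level 0 world over \<open>G\<close> every strict successor is a state containing
  \<open>G\<close>, so all bulleted hypotheses are forced. Soundness gives \<open>Bul B\<close>
  there, and the initial search state is one of the strict successors.\<close>

lemma la_shift:
  assumes "la (Bul ` G) (Bul B)"
  shows "la G B"
proof -
  have wf: "wfset G" "wf B"
    using la_wf[OF assms] by (auto simp: wfset_def dest: finite_imageD intro: inj_onI)
  obtain K where K: "0 < K" "search K (Pair 0 ` G) 0 B \<longrightarrow> la G B"
    using search_sound[OF wf] by blast
  define e :: "nat \<times> (nat \<times> ty) set \<Rightarrow> nat \<times> (nat \<times> ty) set" where "e = id"
  interpret search_model e K by unfold_locales (simp add: e_def)
  let ?G = "Pair 0 ` G :: (nat \<times> ty) set"
  have W: "e (0, ?G) \<in> Ws" by (simp only: e_W)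
  have "forced xs (e (0, ?G)) (Bul A)" if A: "A \<in> G" for A
  proof -
    have wfA: "wf A" using A wf by (simp add: wfset_def)
    have "forced xs q A" if "Ss (e (0, ?G)) q" for q
      using that
    proof (rule Ss_cases)
      fix l H assume "q = e (Suc l, H)" "l < K" "?G \<subseteq> H"
      then show ?thesis
        using A wfA usable_mono[OF usable_mem[of 0 A ?G], of H l] by (auto intro: usable_forced)
    qed
    then show ?thesis using W wfA by (simp add: forced_Bul)
  qed
  then have "forced xs (e (0, ?G)) (Bul B)"
    using W by (intro la_sound[OF assms hereditary_xs]) auto
  moreover have "Ss (e (0, ?G)) (e (Suc 0, ?G))" using K(1) by (simp only: e_S) simp
  ultimately have "forced xs (e (Suc 0, ?G)) B" using forced_Bul[OF W wf(2)] by blast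
  then show ?thesis using K wf by (blast intro: forced_search)
qed

text \<open>Obtained semantically, from soundness of subtyping and completeness, instead of by
  induction on subtyping derivations with their assumptions on variables.\<close>

lemma la_subty:
  assumes "subty A B"
  shows "la {A} B"
proof (rule completeness[of id])
  show "wfset {A}" "wf B" using sub_wf assms by (auto simp: subty_def)
next
  fix W :: "(nat \<times> (nat \<times> ty) set) set" and S R \<xi> p
  assume "la_frame W S R" "hereditary R \<xi>" "p \<in> W" "\<forall>A'\<in>{A}. forces W S R \<xi> p A'"
  moreover from this interpret frame W S R by unfold_locales
  show "forces W S R \<xi> p B"
    using sub_sound[of "{}" A B \<xi> p] assms calculation by (simp add: subty_def)
qed simp

subsection \<open>Typing\<close>

lemma dom_bulctx [simp]: "dom (bulctx G) = dom G"
  by (auto simp: bulctx_def dom_def)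

lemma ran_bulctx: "ran (bulctx G) = Bul ` ran G"
  by (force simp: bulctx_def ran_def)

lemma ran_upd: "G x = None \<or> G x = Some A \<Longrightarrow> ran (G(x \<mapsto> A)) = insert A (ran G)"
  by (auto simp: fun_upd_idem insert_absorb intro: ranI)

lemma ran_compat:
  assumes "compat G1 G2"
  shows "ran (G1 ++ G2) = ran G1 \<union> ran G2"
proof -
  have "(G1 ++ G2) x = Some A \<longleftrightarrow> G1 x = Some A \<or> G2 x = Some A" for x A
    using assms unfolding compat_def map_add_Some_iff by (metis IntI domI domIff option.exhaust)
  then show ?thesis unfolding ran_def by blast
qed

lemma wfctx_wfset: "wfctx G \<Longrightarrow> wfset (ran G)"
  by (auto simp: wfctx_def wfset_def finite_ran)

lemma wfctx_upd:
  assumes "G x = None \<or> G x = Some A"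
  shows "wfctx (G(x \<mapsto> A)) \<longleftrightarrow> wfctx G \<and> wf A"
  unfolding wfctx_def ran_upd[of G x A, OF assms] dom_fun_upd by auto

lemma has_type_la: "has_type G M A \<Longrightarrow> la (ran G) A"
proof (induction rule: has_type.induct)
  case (typ_var G x A)
  then show ?case by (intro la_mem wfctx_wfset) (auto intro: ranI)
next
  case (typ_shift G M A)
  then show ?case by (simp only: ran_bulctx) (rule la_shift)
next
  case (typ_top G M)
  then show ?case by (intro la_weaken[OF la_topv] wfctx_wfset) (auto simp: topv_Top)
next
  case (typ_sub G M A B)
  show ?case by (rule la_trans[OF la_subty[OF typ_sub.hyps(2)] typ_sub.IH])
next
  case (typ_lam G x A M B)
  show ?case using typ_lam.IH unfolding ran_upd[of G x A, OF typ_lam.hyps(1)] by (rule la_ArrI)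
next
  case (typ_app G1 M A B G2 N)
  show ?case using la_ArrE[OF typ_app.IH] unfolding ran_compat[OF typ_app.hyps(3)] .
qed

lemma has_type_wfctx: "has_type G M A \<Longrightarrow> wfctx G"
proof (induction rule: has_type.induct)
  case (typ_shift G M A)
  then show ?case by (simp add: wfctx_def ran_bulctx)
next
  case (typ_lam G x A M B)
  then show ?case using wfctx_upd[of G x A] by blast
next
  case (typ_app G1 M A B G2 N)
  then show ?case by (auto simp: wfctx_def ran_compat)
qed auto

lemma has_type_wf: "has_type G M A \<Longrightarrow> wf A"
  using has_type_la la_wf by blast

section \<open>Necessitation and weakening for typings\<close>

lemma wfg_empty [simp]: "wfg {}"
  by (simp add: wfg_def)

lemma subty_sim: "sim A B \<Longrightarrow> subty A B"
  by (simp add: subty_def sub_sim)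

lemma subty_approx: "wf A \<Longrightarrow> subty A (Bul A)"
  by (simp add: subty_def sub_approx)

text \<open>The term stays the same. Bullets are moved across arrows by \<open>sim_L\<close>,
  backwards for abstraction and forwards for application.\<close>

lemma has_type_nec: "has_type G M A \<Longrightarrow> has_type (bulctx G) M (Bul A)"
proof (induction rule: has_type.induct)
  case (typ_var G x A)
  then show ?case
    by (intro has_type.typ_var) (auto simp: wfctx_def ran_bulctx, simp add: bulctx_def)
next
  case (typ_shift G M A)
  show ?case using typ_shift.IH by (rule has_type.typ_shift)
next
  case (typ_top G M)
  then have "wfctx (bulctx G)" by (auto simp: wfctx_def ran_bulctx)
  then show ?case by (blast intro: has_type.typ_sub has_type.typ_top subty_approx wf_Top)
next
  case (typ_sub G M A B)
  then have "subty (Bul A) (Bul B)" by (simp add: subty_def sub_Bul)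
  with typ_sub.IH show ?case by (rule has_type.typ_sub)
next
  case (typ_lam G x A M B)
  have upd: "bulctx (G(x \<mapsto> A)) = (bulctx G)(x \<mapsto> Bul A)" by (auto simp: bulctx_def)
  have "bulctx G x = None \<or> bulctx G x = Some (Bul A)" using typ_lam.hyps(1) by (auto simp: bulctx_def)
  then have "has_type (bulctx G) (Lam x M) (Arr (Bul A) (Bul B))"
    using typ_lam.IH unfolding upd by (rule has_type.typ_lam)
  moreover from this have "wf A" "wf B" using has_type_wf by force+
  ultimately show ?case by (blast intro: has_type.typ_sub subty_sim sim_sym sim_L)
next
  case (typ_app G1 M A B G2 N)
  have "wf A" "wf B" using has_type_wf[OF typ_app.hyps(1)] by auto
  then have "has_type (bulctx G1) M (Arr (Bul A) (Bul B))"
    using typ_app.IH(1) by (blast intro: has_type.typ_sub subty_sim sim_L)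
  moreover have "compat (bulctx G1) (bulctx G2)" using typ_app.hyps by (auto simp: compat_def bulctx_def)
  ultimately have "has_type (bulctx G1 ++ bulctx G2) (App M N) (Bul B)"
    using typ_app.IH(2) by (blast intro: has_type.typ_app)
  moreover have "bulctx G1 ++ bulctx G2 = bulctx (G1 ++ G2)"
    by (auto simp: bulctx_def map_add_def fun_eq_iff split: option.split)
  ultimately show ?case by simp
qed

text \<open>Since terms carry named variables, weakening may clash with bound variables.  It is obtained
  for inhabitation only, by abstracting over the whole context and applying to the new one.\<close>

lemma has_type_close:
  assumes "has_type G M A"
  shows "\<exists>As N. set As \<subseteq> ran G \<and> has_type Map.empty N (foldr Arr As A)"
proof -
  have "finite (dom G)" using has_type_wfctx[OF assms] by (simp add: wfctx_def)
  then show ?thesis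
    using assms
  proof (induction "card (dom G)" arbitrary: G M A)
    case 0
    then have "G = Map.empty" by auto
    then show ?case using 0 by (intro exI[of _ "[]"]) auto
  next
    case (Suc n)
    then obtain x where "x \<in> dom G" by fastforce
    then obtain B where x: "G x = Some B" by auto
    let ?G = "G(x := None)"
    have "?G(x \<mapsto> B) = G" using x by auto
    then have lam: "has_type ?G (Lam x M) (Arr B A)" using Suc.prems by (intro typ_lam) auto
    have "n = card (dom ?G)" "finite (dom ?G)" using Suc.hyps(2) Suc.prems(1) \<open>x \<in> dom G\<close> by auto
    then obtain As N where As: "set As \<subseteq> ran ?G" "has_type Map.empty N (foldr Arr As (Arr B A))"
      using Suc.hyps(1)[OF _ _ lam] by blast
    have "ran ?G \<subseteq> ran G" by (auto simp: ran_def split: if_splits)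
    then show ?case using As x by (intro exI[of _ "As @ [B]"]) (auto intro: ranI)
  qed
qed

lemma typ_app_same: "has_type G M (Arr A B) \<Longrightarrow> has_type G N A \<Longrightarrow> has_type G (App M N) B"
  using typ_app[of G M A B G N] map_add_subsumed1[of G G] by (simp add: compat_def)

lemma has_type_apply:
  "has_type G M (foldr Arr As A) \<Longrightarrow> set As \<subseteq> ran G \<Longrightarrow> \<exists>M. has_type G M A"
proof (induction As arbitrary: M)
  case (Cons B As)
  then obtain x where "G x = Some B" by (auto simp: ran_def)
  then have "has_type G (LV x) B" using has_type_wfctx[OF Cons.prems(1)] by (rule typ_var[rotated])
  then have "has_type G (App M (LV x)) (foldr Arr As A)"
    using Cons.prems(1) by (auto intro: typ_app_same)
  then show ?case using Cons by auto
qed auto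

text \<open>An identity function typed in \<open>G\<close> is applied to the closed term; the union
  of contexts in \<open>typ_app\<close> then yields \<open>G\<close>.\<close>

lemma has_type_weaken_closed:
  assumes "has_type Map.empty N A" "wfctx G"
  shows "\<exists>M. has_type G M A"
proof -
  obtain z where z: "z \<notin> dom G" using assms(2) ex_new_if_finite[of "dom G"] by (auto simp: wfctx_def)
  then have "has_type (G(z \<mapsto> A)) (LV z) A"
    using assms has_type_wf[OF assms(1)] by (intro typ_var) (auto simp: wfctx_def ran_upd domIff)
  then have "has_type G (Lam z (LV z)) (Arr A A)" using z by (intro typ_lam) auto
  from typ_app[OF this assms(1)] show ?thesis by (auto simp: compat_def)
qed

lemma inhabited_weaken:
  assumes "has_type G M A" "ran G \<subseteq> ran H" "wfctx H"
  shows "\<exists>M. has_type H M A"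
proof -
  obtain As N where As: "set As \<subseteq> ran G" "has_type Map.empty N (foldr Arr As A)"
    using has_type_close[OF assms(1)] by blast
  obtain M' where "has_type H M' (foldr Arr As A)"
    using has_type_weaken_closed[OF As(2) assms(3)] by blast
  then show ?thesis using has_type_apply As(1) assms(2) by blast
qed

lemma ex_ctx_ran:
  assumes "wfset G"
  shows "\<exists>H. wfctx H \<and> ran H = G"
proof -
  obtain As where As: "set As = G" using assms finite_list by (auto simp: wfset_def)
  let ?H = "map_of (zip [0..<length As] As)"
  have "ran ?H = G" using As by (simp add: ran_map_of_zip)
  then show ?thesis using assms by (intro exI[of _ ?H]) (auto simp: wfctx_def wfset_def finite_dom_map_of)
qed

text \<open>The context is any one whose range covers the hypotheses, so premises can be typed in a
  common or extended context.\<close>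

lemma la_has_type:
  assumes "la \<Gamma> A" "wfctx G" "\<Gamma> \<subseteq> ran G"
  shows "\<exists>M. has_type G M A"
  using assms
proof (induction arbitrary: G rule: la.induct)
  case (la_assump \<Gamma> A)
  then obtain x where "G x = Some A" by (auto simp: ran_def)
  then show ?case using la_assump.prems typ_var by blast
next
  case (la_nec \<Gamma>1 A \<Gamma>2)
  \<comment> \<open>Only \<open>\<Gamma>1\<close> receives bullets, so its formulas get a context of
    their own; after necessitation the result is carried over to \<open>G\<close> by
    weakening.\<close>
  obtain H where H: "wfctx H" "ran H = \<Gamma>1" using ex_ctx_ran la_wf[OF la_nec.hyps(1)] by blast
  then obtain M where "has_type (bulctx H) M (Bul A)" using la_nec.IH[OF H(1)] has_type_nec by blast
  from inhabited_weaken[OF this] show ?case using la_nec.prems H by (simp add: ran_bulctx)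
next
  case (la_4 \<Gamma> A)
  then show ?case using la_wf[OF la_4.hyps] by (blast intro: typ_sub subty_approx)
next
  case (la_ArrI A \<Gamma> B)
  obtain x where x: "x \<notin> dom G" using la_ArrI.prems ex_new_if_finite[of "dom G"] by (auto simp: wfctx_def)
  have "ran (G(x \<mapsto> A)) = insert A (ran G)" using x by (intro ran_upd) auto
  moreover have "wf A" using la_wf[OF la_ArrI.hyps] by simp
  moreover from this have "wfctx (G(x \<mapsto> A))"
    using la_ArrI.prems x wfctx_upd[of G x A] by (simp add: domIff)
  ultimately have "\<exists>M. has_type (G(x \<mapsto> A)) M B"
    using la_ArrI.prems by (intro la_ArrI.IH) blast+
  then obtain M where "has_type (G(x \<mapsto> A)) M B" ..
  with x have "has_type G (Lam x M) (Arr A B)" by (intro typ_lam) auto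
  then show ?case ..
next
  case (la_ArrE \<Gamma>1 A B \<Gamma>2)
  then show ?case by (meson Un_subset_iff typ_app_same)
next
  case (la_fold \<Gamma> A)
  then show ?case by (blast intro: typ_sub subty_sim sim_sym sim_unfold)
next
  case (la_unfold \<Gamma> A)
  then show ?case using la_wf[OF la_unfold.hyps] by (blast intro: typ_sub subty_sim sim_unfold)
next
  case (la_L \<Gamma> A B)
  have "wf A" "wf B" using la_wf[OF la_L.hyps] by auto
  then show ?case using la_L by (blast intro: typ_sub subty_sim sim_sym sim_L)
next
  case (la_approx \<Gamma> A)
  then show ?case using la_wf[OF la_approx.hyps] by (blast intro: typ_sub subty_approx)
qed

section \<open>The size of the type of worlds, and the equivalence\<close>

instance ty :: countable
  by countable_datatype

text \<open>A level and a set of hypotheses are merged into one set over a countable sum type, the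
  level being its only left element; counting that type gives a set of naturals.\<close>

lemma ex_inj_search_states:
  fixes f :: "nat set \<Rightarrow> 'w"
  assumes "inj f"
  shows "\<exists>e :: nat \<times> (nat \<times> ty) set \<Rightarrow> 'w. inj e"
proof -
  define h :: "nat \<times> (nat \<times> ty) set \<Rightarrow> (nat + nat \<times> ty) set"
    where "h = (\<lambda>(k, G). insert (Inl k) (Inr ` G))"
  have "inj h" by (auto simp: h_def inj_def)
  moreover have "inj (\<lambda>Z :: (nat + nat \<times> ty) set. to_nat ` Z)"
    by (simp add: inj_image_eq_iff inj_def)
  ultimately have "inj (f \<circ> (\<lambda>Z. to_nat ` Z) \<circ> h)" using assms by (intro inj_compose)
  then show ?thesis by blast
qed

text \<open>All frames live on one type of worlds; \<open>big\<close> makes it large enough for the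
  search states, whose hypotheses are arbitrary sets over a countable type.\<close>

theorem theorem10:
  fixes As :: "ty list" and B :: ty
  assumes big: "\<exists>f :: nat set \<Rightarrow> 'w. inj f"
    and wfA: "\<forall>A\<in>set As. wf A" and wfB: "wf B"
  shows "(la (set As) B
          \<longleftrightarrow> (\<exists>xs M. length xs = length As \<and> distinct xs \<and> has_type (map_of (zip xs As)) M B))
       \<and> (la (set As) B
          \<longleftrightarrow> (\<forall>(W :: 'w set) S R \<xi>. la_frame W S R \<longrightarrow> hereditary R \<xi> \<longrightarrow>
                 (\<forall>p\<in>W. (\<forall>A\<in>set As. forces W S R \<xi> p A) \<longrightarrow> forces W S R \<xi> p B)))"
proof (intro conjI iffI)
  assume la: "la (set As) B"
  let ?G = "map_of (zip [0..<length As] As)"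
  have ran: "ran ?G = set As" by (simp add: ran_map_of_zip)
  then have "wfctx ?G" using wfA by (simp add: wfctx_def finite_dom_map_of)
  then show "\<exists>xs M. length xs = length As \<and> distinct xs \<and> has_type (map_of (zip xs As)) M B"
    using la_has_type[OF la] ran by (intro exI[of _ "[0..<length As]"]) auto
next
  assume "\<exists>xs M. length xs = length As \<and> distinct xs \<and> has_type (map_of (zip xs As)) M B"
  then obtain xs M where xs: "length xs = length As" "distinct xs" "has_type (map_of (zip xs As)) M B"
    by blast
  from has_type_la[OF xs(3)] show "la (set As) B" using ran_map_of_zip[OF xs(1,2)] by simp
next
  assume la: "la (set As) B"
  show "\<forall>(W :: 'w set) S R \<xi>. la_frame W S R \<longrightarrow> hereditary R \<xi> \<longrightarrow>
      (\<forall>p\<in>W. (\<forall>A\<in>set As. forces W S R \<xi> p A) \<longrightarrow> forces W S R \<xi> p B)"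
  proof (intro allI impI ballI)
    fix W :: "'w set" and S R \<xi> p
    assume "la_frame W S R" and *: "hereditary R \<xi>" "p \<in> W" "\<forall>A\<in>set As. forces W S R \<xi> p A"
    then interpret frame W S R by unfold_locales
    show "forces W S R \<xi> p B" using la_sound[OF la *(1,2)] *(3) by blast
  qed
next
  assume valid: "\<forall>(W :: 'w set) S R \<xi>. la_frame W S R \<longrightarrow> hereditary R \<xi> \<longrightarrow>
      (\<forall>p\<in>W. (\<forall>A\<in>set As. forces W S R \<xi> p A) \<longrightarrow> forces W S R \<xi> p B)"
  obtain e :: "nat \<times> (nat \<times> ty) set \<Rightarrow> 'w" where "inj e" using big ex_inj_search_states by blast
  then show "la (set As) B"
    by (rule completeness) (use valid wfA wfB in \<open>simp_all add: wfset_def\<close>)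
qed

end
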